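(* Let $\lambda_1,\lambda_2,\mu>0$ with $\rho=(\lambda_1+\lambda_2)/\mu<1$. In the two-class M/M/1 queueing system with arrival rates $\lambda_1,\lambda_2$ and common service rate $\mu$, in which class-1 customers have non-preemptive priority over class-2 customers, the stationary probabilities that the server is occupied by a class-1 customer, that it is occupied by a class-2 customer, and that it is free are respectively $$P_{\text{class-1}}=\sum_{i\ge1,\,j\ge0}p_{ij1}=\frac{\lambda_1}{\mu},\qquad P_{\text{class-2}}=\sum_{i\ge0,\,j\ge1}p_{ij2}=\frac{\lambda_2}{\mu},\qquad P_{\text{free}}=p_{000}=\frac{\mu-\lambda_1-\lambda_2}{\mu}.$$
   Context: Model. A single server with infinite buffer serves two classes of customers. Class-1 and class-2 customers arrive according to independent Poisson processes with rates $\lambda_1$ and $\lambda_2$; all service times are independent, exponential with mean $1/\mu$, and independent of the arrivals. Class-1 customers have non-preemptive priority over class-2 customers: a service in progress is never interrupted, and upon each service completion the server takes a class-1 customer if one is present, otherwise a class-2 customer if one is present, otherwise it becomes free; a customer arriving to a free server starts service at once; within a class the order is first come, first served. $N_i(t)$ is the number of class-$i$ customers in the system (including the one in service) at time $t$, and $\xi(t)\in\{0,1,2\}$ is $0$ if the server is free, and $1$ or $2$ if it is serving a class-1 or class-2 customer. $(N_1(t),N_2(t),\xi(t))$ is a continuous-time Markov chain on the states $(0,0,0)$; $(i,j,1)$ with $i\ge1,j\ge0$; $(i,j,2)$ with $i\ge0,j\ge1$. Its transitions are: - from $(0,0,0)$ to $(1,0,1)$ at rate $\lambda_1$ and to $(0,1,2)$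 at rate $\lambda_2$; - from $(i,j,k)$ with $k\in\{1,2\}$ to $(i+1,j,k)$ at rate $\lambda_1$ and to $(i,j+1,k)$ at rate $\lambda_2$; - from $(i,j,1)$ at rate $\mu$ to $(i-1,j,k')$, and from $(i,j,2)$ at rate $\mu$ to $(i,j-1,k')$, where, for the new numbers $(i',j')$ of customers, $k'=1$ if $i'\ge1$, $k'=2$ if $i'=0,j'\ge1$, and $k'=0$ if $i'=j'=0$. The stationary probabilities are $p_{ijk}=\lim_{t\to\infty}\Pr\{N_1(t)=i,N_2(t)=j,\xi(t)=k\}$. *)

theory Defs
  imports "HOL-Probability.Probability"
begin

definition transition_function :: "'s set \<Rightarrow> (real \<Rightarrow> 's \<Rightarrow> 's \<Rightarrow> real) \<Rightarrow> bool" where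
  "transition_function S P \<longleftrightarrow>
     (\<forall>t\<ge>0. \<forall>x\<in>S. (\<forall>y\<in>S. 0 \<le> P t x y) \<and> ((\<lambda>y. P t x y) has_sum 1) S) \<and>
     (\<forall>x\<in>S. \<forall>y\<in>S. P 0 x y = (if x = y then 1 else 0)) \<and>
     (\<forall>s\<ge>0. \<forall>t\<ge>0. \<forall>x\<in>S. \<forall>y\<in>S. ((\<lambda>z. P s x z * P t z y) has_sum P (s + t) x y) S)"

(* q x y is the rate of the transition from x to y, meaningful only for x and y distinct;
   the diagonal of the generator is minus the total exit rate. *)
definition transition_rates :: "'s set \<Rightarrow> ('s \<Rightarrow> 's \<Rightarrow> real) \<Rightarrow> bool" where
  "transition_rates S q \<longleftrightarrow>
     (\<forall>x\<in>S. (\<forall>y\<in>S - {x}. 0 \<le> q x y) \<and> (\<lambda>y. q x y) summable_on (S - {x}))"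

definition generator :: "'s set \<Rightarrow> ('s \<Rightarrow> 's \<Rightarrow> real) \<Rightarrow> 's \<Rightarrow> 's \<Rightarrow> real" where
  "generator S q x y = (if x = y then - (\<Sum>\<^sub>\<infinity>z\<in>S - {x}. q x z) else q x y)"

(* Time-homogeneous chain with time set {0..} and arbitrary initial distribution. *)
locale continuous_time_markov_chain = prob_space M
  for M :: "'w measure" and S :: "'s set" and q :: "'s \<Rightarrow> 's \<Rightarrow> real"
    and X :: "real \<Rightarrow> 'w \<Rightarrow> 's" +
  assumes countable_states: "countable S"
    and rates: "transition_rates S q"
    and measurable_process: "\<And>t. 0 \<le> t \<Longrightarrow> X t \<in> M \<rightarrow>\<^sub>M count_space S"
    and markov: "\<exists>P. transition_function S P \<and>
      (\<forall>x\<in>S. \<forall>y\<in>S. ((\<lambda>t. P t x y) has_real_derivative generator S q x y) (at 0 within {0..})) \<and>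
      (\<forall>(n::nat) \<tau> s. 0 \<le> \<tau> 0 \<longrightarrow> strict_mono \<tau> \<longrightarrow> (\<forall>m. s m \<in> S) \<longrightarrow>
         \<P>(\<omega> in M. \<forall>m\<le>n. X (\<tau> m) \<omega> = s m) \<noteq> 0 \<longrightarrow>
         \<P>(\<omega> in M. X (\<tau> (Suc n)) \<omega> = s (Suc n) \<bar> \<forall>m\<le>n. X (\<tau> m) \<omega> = s m)
           = P (\<tau> (Suc n) - \<tau> n) (s n) (s (Suc n)))"

(* (i, j, k): i class-1 and j class-2 customers in the system; the server is free if k = 0
   and serves a class-k customer otherwise. *)
type_synonym state = "nat \<times> nat \<times> nat"

definition priority_states :: "state set" where
  "priority_states =
     {(0, 0, 0)} \<union> {(i, j, 1) |i j. 1 \<le> i} \<union> {(i, j, 2) |i j. 1 \<le> j}"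

definition next_service :: "nat \<Rightarrow> nat \<Rightarrow> nat" where
  "next_service i j = (if 1 \<le> i then 1 else if 1 \<le> j then 2 else 0)"

(* The targets of the three kinds of transition out of a state are distinct, so the sums
   never merge two of them. *)
fun priority_rate :: "real \<Rightarrow> real \<Rightarrow> real \<Rightarrow> state \<Rightarrow> state \<Rightarrow> real" where
  "priority_rate lam\<^sub>1 lam\<^sub>2 \<mu> (i, j, k) y =
     (if k = 0 then
        lam\<^sub>1 * of_bool (y = (1, 0, 1)) + lam\<^sub>2 * of_bool (y = (0, 1, 2))
      else
        lam\<^sub>1 * of_bool (y = (i + 1, j, k)) + lam\<^sub>2 * of_bool (y = (i, j + 1, k)) +
        \<mu> * of_bool (y = (if k = 1 then (i - 1, j, next_service (i - 1) j)
                          else (i, j - 1, next_service i (j - 1)))))"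

locale priority_queue =
  continuous_time_markov_chain M priority_states "priority_rate lam\<^sub>1 lam\<^sub>2 \<mu>"
    "\<lambda>t \<omega>. (N\<^sub>1 t \<omega>, N\<^sub>2 t \<omega>, \<xi> t \<omega>)"
  for M :: "'w measure" and lam\<^sub>1 lam\<^sub>2 \<mu> :: real and N\<^sub>1 N\<^sub>2 \<xi> :: "real \<Rightarrow> 'w \<Rightarrow> nat"

end

theory Submission
  imports Defs
begin

text \<open>
The rates out of a state are bounded by $\lambda_1+\lambda_2+\mu$, so the chain can be observed
at the epochs of a Poisson process of that rate: the transition function is a Poisson mixture of
the powers of a discrete jump chain, in which the next event is a class-1 arrival, a class-2
arrival or a service completion with probabilities proportional to $\lambda_1$, $\lambda_2$,
$\mu$, a completion in the empty state changing nothing. This is \<open>uniformization\<close>; it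
follows from Kolmogorov's backward equation (\<open>kolmogorov_backward\<close>), which for rows of finite
support holds under the mere existence of the derivatives at time 0. Since Poisson averages of a
convergent sequence have the same limit (\<open>poisson_average_tendsto\<close>), it is enough to study the
iterates $K^n f$ of the jump operator $K$ on bounded functions $f$.

The total number of customers does not notice the priorities: it is a reflected random walk whose
tail probabilities, started empty, increase with $n$, stay below $\rho^k$, and satisfy in the limit
the balance equations, so that they converge to $\rho^k$ (\<open>tail_limit\<close>). In particular
the empty state has limiting probability $1-\rho$. For a bounded $f$ vanishing in the empty state,
splitting paths at the last visit to the empty state writes $K^n f$ as the convolution of a
summable sequence with the probabilities of being empty, plus a term that vanishes because the
empty state is reached in finite mean time (\<open>last_exit_decomposition\<close>, \<open>taboo_sum_bound\<close>).
Adding multiples of the indicator of the empty state, one finds that $K^n f(x)$ has a limit for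
every bounded $f$, independent of $x$: the functional \<open>equilibrium\<close>.

The functional is invariant under $K$. Applied to the number of class-1 customers truncated at
$m$, invariance says that class-1 arrivals balance class-1 completions up to an error of order
$\rho^m$, whence the probability of serving class 1 is $\lambda_1/\mu$
(\<open>equilibrium_class_1\<close>); the remaining mass $\rho-\lambda_1/\mu$ belongs to class 2. The
geometric tail bound also makes the functional countably additive (\<open>equilibrium_has_sum\<close>), which
turns these values into sums of the individual limits.
\<close>


section \<open>Transition functions and the backward equation\<close>

lemma transition_function_bounds:
  assumes P: "transition_function S P" and "x \<in> S" "y \<in> S" "0 \<le> t"
  shows "0 \<le> P t x y" "P t x y \<le> 1"
proof -
  show *: "0 \<le> P t x y"
    using assms unfolding transition_function_def by blast
  have "((\<lambda>v. P t x v) has_sum 1) S"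
    using assms unfolding transition_function_def by blast
  from finite_sum_le_has_sum[OF this, of "{y}"] show "P t x y \<le> 1"
    using assms unfolding transition_function_def by auto
qed

text \<open>Cutting the Chapman-Kolmogorov sum down to a finite set loses at most the mass of the first step
outside that set. This replaces any uniformity assumption in the derivation of the backward equation.\<close>

lemma transition_function_finite_part:
  assumes P: "transition_function S P" and "x \<in> S" "y \<in> S" "0 \<le> h" "0 \<le> m"
    and F: "finite F" "F \<subseteq> S"
  shows "0 \<le> P (h + m) x y - (\<Sum>z\<in>F. P h x z * P m z y)"
    and "P (h + m) x y - (\<Sum>z\<in>F. P h x z * P m z y) \<le> 1 - (\<Sum>z\<in>F. P h x z)"
proof -
  note bounds = transition_function_bounds[OF P]
  have mass: "((\<lambda>v. P t u v) has_sum 1) S" if "0 \<le> t" "u \<in> S" for t u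
    using P that unfolding transition_function_def by blast
  have CK: "((\<lambda>z. P h x z * P m z y) has_sum P (h + m) x y) S"
    using P assms(2-5) unfolding transition_function_def by blast
  have 1: "((\<lambda>z. P h x z * P m z y) has_sum (P (h + m) x y - (\<Sum>z\<in>F. P h x z * P m z y))) (S - F)"
    by (rule has_sum_Diff[OF CK has_sum_finite[OF F(1)] F(2)])
  have 2: "((\<lambda>z. P h x z) has_sum (1 - (\<Sum>z\<in>F. P h x z))) (S - F)"
    using assms by (intro has_sum_Diff[OF mass has_sum_finite[OF F(1)] F(2)]) auto
  show "0 \<le> P (h + m) x y - (\<Sum>z\<in>F. P h x z * P m z y)"
    using has_sum_nonneg[OF 1] bounds assms by auto
  show "P (h + m) x y - (\<Sum>z\<in>F. P h x z * P m z y) \<le> 1 - (\<Sum>z\<in>F. P h x z)"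
    by (rule has_sum_mono[OF 1 2]) (use bounds assms in \<open>auto intro!: mult_left_le\<close>)
qed

text \<open>The modulus of continuity in time is controlled by the probability of having left the starting
state, uniformly in the target state.\<close>

lemma transition_function_modulus:
  assumes P: "transition_function S P" and xy: "x \<in> S" "y \<in> S" and st: "0 \<le> s" "0 \<le> t"
  shows "\<bar>P s x y - P t x y\<bar> \<le> 1 - P \<bar>s - t\<bar> x x"
proof -
  define h m where "h = \<bar>s - t\<bar>" and "m = min s t"
  have hm: "0 \<le> h" "0 \<le> m" "{h + m, m} = {s, t}"
    using st by (auto simp: h_def m_def min_def)
  have 1: "0 \<le> P (h + m) x y - P h x x * P m x y"
          "P (h + m) x y - P h x x * P m x y \<le> 1 - P h x x"
    using transition_function_finite_part[OF P xy hm(1,2), of "{x}"] xy by auto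
  have 2: "0 \<le> (1 - P h x x) * P m x y" "(1 - P h x x) * P m x y \<le> 1 - P h x x"
    using transition_function_bounds[OF P] xy hm by (auto intro!: mult_left_le)
  have "\<bar>P (h + m) x y - P m x y\<bar> \<le> 1 - P h x x"
    using 1 2 by (auto simp: algebra_simps abs_le_iff)
  thus ?thesis
    using hm(3) unfolding doubleton_eq_iff h_def[symmetric] by (auto simp: abs_minus_commute)
qed

lemma filterlim_abs_diff_at_0:
  fixes t :: real
  assumes "0 \<le> t"
  shows "filterlim (\<lambda>s. \<bar>s - t\<bar>) (at 0 within {0..}) (at t within {0..})"
  unfolding filterlim_at
  by (auto intro!: tendsto_eq_intros simp: eventually_at_filter)

lemma transition_function_continuous:
  assumes P: "transition_function S P" and xy: "x \<in> S" "y \<in> S"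
    and D: "((\<lambda>t. P t x x) has_real_derivative d) (at 0 within {0..})"
  shows "continuous_on {0..} (\<lambda>t. P t x y)"
  unfolding continuous_on_def
proof
  fix t :: real assume t: "t \<in> {0..}"
  have P0: "P 0 x x = 1"
    using P xy unfolding transition_function_def by auto
  have "((\<lambda>t. P t x x) \<longlongrightarrow> P 0 x x) (at 0 within {0..})"
    using DERIV_continuous[OF D] by (simp add: continuous_within)
  hence "((\<lambda>s. 1 - P \<bar>s - t\<bar> x x) \<longlongrightarrow> 1 - P 0 x x) (at t within {0..})"
    using t by (intro tendsto_intros filterlim_compose[OF _ filterlim_abs_diff_at_0]) auto
  hence "((\<lambda>s. 1 - P \<bar>s - t\<bar> x x) \<longlongrightarrow> 0) (at t within {0..})"
    by (simp add: P0)
  moreover have "\<forall>\<^sub>F s in at t within {0..}. norm (P s x y - P t x y) \<le> 1 - P \<bar>s - t\<bar> x x"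
    using transition_function_modulus[OF P xy] t by (auto simp: eventually_at_filter)
  ultimately have "((\<lambda>s. P s x y - P t x y) \<longlongrightarrow> 0) (at t within {0..})"
    by (rule Lim_null_comparison[rotated])
  thus "((\<lambda>s. P s x y) \<longlongrightarrow> P t x y) (at t within {0..})"
    by (simp add: LIM_zero_iff)
qed

text \<open>Split the first $h$ time units from the rest. The finitely many states of \<open>F\<close> contribute the
claimed derivative; the mass that leaves \<open>F\<close> is $o(h)$, because the derivatives over \<open>F\<close>
already sum to zero. The argument is symmetric in the sign of the increment, which gives two-sided
derivatives at positive times: the first $h=|s-t|$ time units are followed by a period of
length $\min(s,t)$.\<close>

lemma kolmogorov_backward:
  assumes P: "transition_function S P" and xy: "x \<in> S" "y \<in> S" and t: "0 \<le> t"
    and F: "finite F" "F \<subseteq> S" "x \<in> F"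
    and row: "\<And>z. z \<in> F \<Longrightarrow> ((\<lambda>s. P s x z) has_real_derivative g z) (at 0 within {0..})"
    and conservative: "(\<Sum>z\<in>F. g z) = 0"
    and diag: "\<And>z. z \<in> F \<Longrightarrow> ((\<lambda>s. P s z z) has_real_derivative d z) (at 0 within {0..})"
  shows "((\<lambda>s. P s x y) has_real_derivative (\<Sum>z\<in>F. g z * P t z y)) (at t within {0..})"
proof -
  let ?\<F> = "at t within {0..}"
  define A where "A z s = (P \<bar>s - t\<bar> x z - of_bool (z = x)) / \<bar>s - t\<bar>" for z s
  define Q where "Q z s = P (min s t) z y" for z s
  define R where "R s = (P s x y - P t x y) / (s - t) - (\<Sum>z\<in>F. A z s * Q z s)" for s
  have P0: "P 0 x z = of_bool (z = x)" if "z \<in> F" for z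
    using P that F xy unfolding transition_function_def by auto
  have A: "(A z \<longlongrightarrow> g z) ?\<F>" if "z \<in> F" for z
  proof -
    have "((\<lambda>h. (P h x z - P 0 x z) / (h - 0)) \<longlongrightarrow> g z) (at 0 within {0..})"
      using row[OF that] unfolding has_field_derivative_iff .
    from filterlim_compose[OF this filterlim_abs_diff_at_0[OF t]] show ?thesis
      unfolding A_def by (simp add: P0[OF that])
  qed
  have Q: "(Q z \<longlongrightarrow> P t z y) ?\<F>" if "z \<in> F" for z
  proof -
    have "continuous_on {0..} (\<lambda>s. P s z y)"
      by (rule transition_function_continuous[OF P _ _ diag[OF that]]) (use that F xy in auto)
    hence "continuous_on {0..} (\<lambda>s. P (min s t) z y)"
      by (rule continuous_on_compose2) (use t in \<open>auto intro!: continuous_intros\<close>)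
    thus ?thesis
      using t unfolding continuous_on_def Q_def by force
  qed
  have "\<forall>\<^sub>F s in ?\<F>. norm (R s) \<le> - (\<Sum>z\<in>F. A z s)"
    unfolding eventually_at_filter
  proof (intro always_eventually allI impI)
    fix s assume s: "s \<noteq> t" "s \<in> {0..}"
    define h m where "h = \<bar>s - t\<bar>" and "m = min s t"
    have hm: "0 < h" "0 \<le> m" using s t by (auto simp: h_def m_def)
    have delta: "(\<Sum>z\<in>F. of_bool (z = x) * f z) = f x" for f :: "_ \<Rightarrow> real"
    proof -
      have "(\<Sum>z\<in>F. of_bool (z = x) * f z) = (\<Sum>z\<in>F. if z = x then f z else 0)"
        by (intro sum.cong) auto
      thus ?thesis using F by simp
    qed
    have quot: "(P s x y - P t x y) / (s - t) = (P (h + m) x y - P m x y) / h"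
    proof (cases "s < t")
      case True
      hence eq: "s - t = - h" "m = s" "h + s = t" by (auto simp: h_def m_def)
      show ?thesis using hm(1) by (simp add: eq divide_simps)
    next
      case False
      hence "h = s - t" "m = t" "h + m = s" using s by (auto simp: h_def m_def)
      thus ?thesis by simp
    qed
    have "(\<Sum>z\<in>F. A z s * Q z s) = ((\<Sum>z\<in>F. P h x z * P m z y) - P m x y) / h"
      using delta[of "\<lambda>z. P m z y"]
      by (simp add: A_def Q_def h_def[symmetric] m_def[symmetric] sum_divide_distrib[symmetric]
            left_diff_distrib sum_subtractf)
    hence R: "R s = (P (h + m) x y - (\<Sum>z\<in>F. P h x z * P m z y)) / h"
      unfolding R_def quot by (simp add: diff_divide_distrib)
    have A: "- (\<Sum>z\<in>F. A z s) = (1 - (\<Sum>z\<in>F. P h x z)) / h"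
      using delta[of "\<lambda>_. 1"]
      by (simp add: A_def h_def[symmetric] sum_divide_distrib[symmetric] sum_subtractf
          minus_divide_left)
    show "norm (R s) \<le> - (\<Sum>z\<in>F. A z s)"
      using transition_function_finite_part[OF P xy less_imp_le[OF hm(1)] hm(2) F(1,2)] hm(1)
      unfolding R A by (auto simp: divide_right_mono)
  qed
  moreover have "((\<lambda>s. - (\<Sum>z\<in>F. A z s)) \<longlongrightarrow> 0) ?\<F>"
  proof -
    have "((\<lambda>s. - (\<Sum>z\<in>F. A z s)) \<longlongrightarrow> - (\<Sum>z\<in>F. g z)) ?\<F>"
      by (intro tendsto_intros A)
    thus ?thesis by (simp add: conservative)
  qed
  ultimately have "(R \<longlongrightarrow> 0) ?\<F>"
    by (rule Lim_null_comparison)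
  moreover have "((\<lambda>s. \<Sum>z\<in>F. A z s * Q z s) \<longlongrightarrow> (\<Sum>z\<in>F. g z * P t z y)) ?\<F>"
    by (intro tendsto_intros A Q)
  ultimately have "((\<lambda>s. R s + (\<Sum>z\<in>F. A z s * Q z s)) \<longlongrightarrow> 0 + (\<Sum>z\<in>F. g z * P t z y)) ?\<F>"
    by (rule tendsto_add)
  thus ?thesis
    unfolding has_field_derivative_iff by (simp add: R_def)
qed

section \<open>Poisson averages and exponential series\<close>

text \<open>Under a Poisson law with mean \<open>s\<close>, every fixed finite set of indices loses its weight as \<open>s\<close>
grows. The averages \<open>F s\<close> are given through their exponential generating function.\<close>

lemma poisson_average_tendsto:
  fixes u :: "nat \<Rightarrow> real" and F :: "real \<Rightarrow> real"
  assumes u: "u \<longlonglongrightarrow> L" and F: "\<And>s. 0 \<le> s \<Longrightarrow> (\<lambda>n. s ^ n / fact n * u n) sums (exp s * F s)"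
  shows "(F \<longlongrightarrow> L) at_top"
proof (rule tendstoI)
  fix e :: real assume e: "0 < e"
  have expo: "(\<lambda>n. s ^ n / fact n) sums exp s" for s :: real
    using exp_converges[of s] by (simp add: divide_inverse mult.commute)
  have "Bseq (\<lambda>n. u n - L)"
    using u by (intro convergent_imp_Bseq convergentI[of _ 0]) (simp add: LIM_zero)
  then obtain B where B: "0 < B" "\<And>n. \<bar>u n - L\<bar> \<le> B"
    by (auto simp: Bseq_def)
  obtain N where N: "\<And>n. N \<le> n \<Longrightarrow> \<bar>u n - L\<bar> < e / 2"
    using LIMSEQ_D[OF u, of "e / 2"] e by auto
  have bound: "\<bar>F s - L\<bar> \<le> e / 2 + B * (\<Sum>n<N. s ^ n / exp s / fact n)" if s: "0 \<le> s" for s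
  proof -
    define d where "d n = s ^ n / fact n * (u n - L)" for n
    define D where "D n = e / 2 * (s ^ n / fact n) + (if n < N then B * (s ^ n / fact n) else 0)" for n
    have d: "d sums (exp s * F s - exp s * L)"
      using sums_diff[OF F[OF s] sums_mult2[OF expo[of s], of L]]
      by (simp add: d_def[abs_def] algebra_simps diff_divide_distrib)
    have D: "D sums (e / 2 * exp s + (\<Sum>n<N. B * (s ^ n / fact n)))"
      unfolding D_def
      using sums_add[OF sums_mult[OF expo[of s], of "e / 2"] sums_If_finite_set[of "{..<N}" "\<lambda>n. B * (s ^ n / fact n)"]]
      by simp
    have "\<bar>d n\<bar> \<le> D n" for n
    proof -
      \<comment> \<open>The first \<open>N\<close> terms are bounded crudely by \<open>B\<close>, all later ones by \<open>e / 2\<close>.\<close>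
      have "\<bar>d n\<bar> = s ^ n / fact n * \<bar>u n - L\<bar>"
        using s by (simp add: d_def abs_mult)
      also have "\<dots> \<le> s ^ n / fact n * (e / 2 + (if n < N then B else 0))"
        using B(2)[of n] N[of n] e s by (intro mult_left_mono) auto
      also have "\<dots> = D n" by (simp add: D_def algebra_simps)
      finally show ?thesis .
    qed
    hence "d n \<le> D n" "- d n \<le> D n" for n
      by (auto simp: abs_le_iff)
    from sums_le[OF this(1) d D] sums_le[OF this(2) sums_minus[OF d] D]
    have "exp s * \<bar>F s - L\<bar> \<le> e / 2 * exp s + B * (\<Sum>n<N. s ^ n / fact n)"
      by (auto simp: abs_if sum_distrib_left algebra_simps)
    hence "\<bar>F s - L\<bar> \<le> (e / 2 * exp s + B * (\<Sum>n<N. s ^ n / fact n)) / exp s"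
      by (simp add: pos_le_divide_eq mult.commute)
    also have "\<dots> = e / 2 + B * (\<Sum>n<N. s ^ n / exp s / fact n)"
    proof -
      have "(\<Sum>n<N. s ^ n / exp s / fact n) = (\<Sum>n<N. s ^ n / fact n) / exp s"
        by (simp add: sum_divide_distrib mult.commute)
      thus ?thesis by (simp only:) (simp add: add_divide_distrib)
    qed
    finally show ?thesis .
  qed
  have "((\<lambda>s. B * (\<Sum>n<N. s ^ n / exp s / fact n)) \<longlongrightarrow> B * (\<Sum>n<N. 0 / fact n)) at_top"
    by (intro tendsto_intros tendsto_power_div_exp_0) auto
  hence "\<forall>\<^sub>F s in at_top. B * (\<Sum>n<N. s ^ n / exp s / fact n) < e / 2"
    using e by (intro order_tendstoD) auto
  thus "\<forall>\<^sub>F s in at_top. dist (F s) L < e"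
    using eventually_ge_at_top[of 0]
  proof eventually_elim
    case (elim s)
    thus ?case using bound[of s] by (simp add: dist_real_def)
  qed
qed

lemma exp_term_derivative:
  fixes L :: real
  shows "((\<lambda>s. (L * s) ^ Suc n / fact (Suc n)) has_real_derivative L * ((L * s) ^ n / fact n)) (at s within A)"
proof -
  have "((\<lambda>s. L * s) has_real_derivative L) (at s within A)"
    by (auto intro!: derivative_eq_intros)
  from DERIV_cdivide[OF DERIV_power[OF this, of "Suc n"], of "fact (Suc n)"] show ?thesis
    by (simp add: field_simps del: of_nat_Suc power_Suc)
qed

lemma exp_partial_sum_derivative:
  fixes L :: real
  shows "((\<lambda>s. \<Sum>k<Suc n. (L * s) ^ k / fact k * c k) has_real_derivative
          L * (\<Sum>k<n. (L * s) ^ k / fact k * c (Suc k))) (at s within A)"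
proof (induction n)
  case (Suc n)
  from DERIV_add[OF Suc DERIV_cmult_right[OF exp_term_derivative[of L n s A], of "c (Suc n)"]]
  show ?case by (simp add: distrib_left mult.assoc)
qed simp

section \<open>Limits, bounded functions and geometric sequences\<close>

text \<open>The renewal-type limit used below: one factor is summable, the other bounded and convergent, so the
sum over \<open>r\<close> and the limit may be exchanged by dominated convergence for series.\<close>

lemma convolution_limit:
  fixes c v :: "nat \<Rightarrow> real"
  assumes "summable (\<lambda>r. \<bar>c r\<bar>)" "\<And>n. \<bar>v n\<bar> \<le> 1" "v \<longlonglongrightarrow> L"
  shows "(\<lambda>n. \<Sum>r<n. c r * v (n - Suc r)) \<longlonglongrightarrow> (\<Sum>r. c r * L)"
proof -
  let ?a = "\<lambda>r n. if r < n then c r * v (n - Suc r) else 0"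
  have "(\<lambda>n. \<Sum>r. ?a r n) \<longlonglongrightarrow> (\<Sum>r. c r * L)"
  proof (rule tannerys_theorem[THEN conjunct2, THEN conjunct2])
    show "(\<lambda>n. ?a r n) \<longlonglongrightarrow> c r * L" for r
    proof (rule LIMSEQ_offset[where k = "Suc r"])
      show "(\<lambda>n. ?a r (n + Suc r)) \<longlonglongrightarrow> c r * L"
        using assms(3) by (auto intro!: tendsto_intros)
    qed
    show "\<forall>\<^sub>F (r, n) in at_top \<times>\<^sub>F sequentially. norm (?a r n) \<le> \<bar>c r\<bar>"
      using assms(2) by (auto intro!: always_eventually mult_left_le simp: abs_mult)
  qed (use assms in auto)
  moreover have "(\<Sum>r. ?a r n) = (\<Sum>r<n. c r * v (n - Suc r))" for n
    by (subst suminf_finite[of "{..<n}"]) auto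
  ultimately show ?thesis by simp
qed

lemma bounded_of_bool: "bounded ((\<lambda>x. of_bool (Q x) :: real) ` A)"
  by (rule bounded_subset[of "{0, 1}"]) auto

lemma bounded_const_image: "bounded ((\<lambda>_. c :: real) ` A)"
  by (rule bounded_subset[of "{c}"]) auto

lemma bounded_linear_combination:
  fixes f g :: "'a \<Rightarrow> real"
  assumes "bounded (f ` A)" "bounded (g ` A)"
  shows "bounded ((\<lambda>x. c * f x + d * g x) ` A)"
proof -
  from assms obtain B C where "\<And>x. x \<in> A \<Longrightarrow> \<bar>f x\<bar> \<le> B" "\<And>x. x \<in> A \<Longrightarrow> \<bar>g x\<bar> \<le> C"
    by (auto simp: bounded_iff)
  hence "\<bar>c * f x + d * g x\<bar> \<le> \<bar>c\<bar> * B + \<bar>d\<bar> * C" if "x \<in> A" for x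
    using that by (intro order_trans[OF abs_triangle_ineq] add_mono) (auto simp: abs_mult mult_left_mono)
  thus ?thesis by (auto simp: bounded_iff)
qed

text \<open>The balance equations make consecutive differences geometric with ratio \<open>a / b\<close>; this leaves a
one-parameter family of solutions with \<open>T 0 = 1\<close>, of which only one vanishes at infinity.\<close>

lemma geometric_if_balanced:
  fixes T :: "nat \<Rightarrow> real"
  assumes "0 < a" "a < b"
    and bal: "\<And>k. (a + b) * T (Suc k) = a * T k + b * T (Suc (Suc k))"
    and T0: "T 0 = 1" and lim: "T \<longlonglongrightarrow> 0"
  shows "T k = (a / b) ^ k"
proof -
  define r where "r = a / b"
  have r: "0 < r" "r < 1" using assms by (auto simp: r_def)
  have step: "T (Suc k) - T (Suc (Suc k)) = r * (T k - T (Suc k))" for k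
    using bal[of k] assms(1,2) by (simp add: r_def field_simps)
  have diff: "T k - T (Suc k) = r ^ k * (1 - T 1)" for k
    by (induction k) (auto simp: T0 step)
  define c where "c = (1 - T 1) / (1 - r)"
  have c: "1 - T 1 = c * (1 - r)" using r by (simp add: c_def)
  have T: "T k = 1 - c * (1 - r ^ k)" for k
  proof (induction k)
    case (Suc k)
    have "T (Suc k) = T k - r ^ k * (c * (1 - r))" using diff[of k] unfolding c by simp
    with Suc show ?case by (simp add: algebra_simps)
  qed (simp add: T0)
  have "(\<lambda>k. 1 - c * (1 - r ^ k)) \<longlonglongrightarrow> 1 - c * (1 - 0)"
    using r by (intro tendsto_intros LIMSEQ_realpow_zero) auto
  hence "T \<longlonglongrightarrow> 1 - c"
    unfolding T[symmetric] by simp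
  hence "c = 1"
    using LIMSEQ_unique[OF lim] by fastforce
  thus ?thesis using T[of k] by (simp add: r_def)
qed

section \<open>Partition of a probability by a discrete random variable\<close>

lemma (in prob_space) prob_partition:
  assumes S: "countable S" and X: "X \<in> M \<rightarrow>\<^sub>M count_space S" and E: "E \<in> events"
  shows "integrable (count_space S) (\<lambda>x. prob ({\<omega>\<in>space M. X \<omega> = x} \<inter> E))"
    and "(\<integral>x. prob ({\<omega>\<in>space M. X \<omega> = x} \<inter> E) \<partial>count_space S) = prob E"
proof -
  have ev: "{\<omega>\<in>space M. X \<omega> = x} \<inter> E \<in> events" if "x \<in> S" for x
  proof -
    have "X -` {x} \<inter> space M \<in> events" using that by (intro measurable_sets[OF X]) auto
    moreover have "{\<omega>\<in>space M. X \<omega> = x} = X -` {x} \<inter> space M" by auto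
    ultimately show ?thesis using E by auto
  qed
  have "E = (\<Union>x\<in>S. {\<omega>\<in>space M. X \<omega> = x} \<inter> E)"
    using measurable_space[OF X] sets.sets_into_space[OF E] by auto
  hence "emeasure M E = emeasure M (\<Union>x\<in>S. {\<omega>\<in>space M. X \<omega> = x} \<inter> E)" by simp
  also have "\<dots> = (\<integral>\<^sup>+x. emeasure M ({\<omega>\<in>space M. X \<omega> = x} \<inter> E) \<partial>count_space S)"
    by (rule emeasure_UN_countable[OF _ S]) (auto simp: disjoint_family_on_def ev)
  finally have nn: "(\<integral>\<^sup>+x. ennreal (prob ({\<omega>\<in>space M. X \<omega> = x} \<inter> E)) \<partial>count_space S) = ennreal (prob E)"
    by (simp add: emeasure_eq_measure)
  show "integrable (count_space S) (\<lambda>x. prob ({\<omega>\<in>space M. X \<omega> = x} \<inter> E))"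
    by (rule integrableI_nn_integral_finite[OF _ _ nn]) auto
  show "(\<integral>x. prob ({\<omega>\<in>space M. X \<omega> = x} \<inter> E) \<partial>count_space S) = prob E"
    by (subst integral_eq_nn_integral) (auto simp: nn)
qed

text \<open>The law at time \<open>t\<close> mixes the rows of the transition function with the initial law, so a limit
common to all rows is the limit of the marginal law, by dominated convergence.\<close>

lemma (in continuous_time_markov_chain) marginal_limit:
  assumes P: "transition_function S P"
    and step: "\<And>t x. 0 < t \<Longrightarrow> x \<in> S \<Longrightarrow> \<P>(\<omega> in M. X 0 \<omega> = x) \<noteq> 0 \<Longrightarrow>
        \<P>(\<omega> in M. X t \<omega> = y \<bar> X 0 \<omega> = x) = P t x y"
    and y: "y \<in> S"
    and lim: "\<And>x. x \<in> S \<Longrightarrow> ((\<lambda>t. P t x y) \<longlongrightarrow> c) at_top"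
  shows "((\<lambda>t. \<P>(\<omega> in M. X t \<omega> = y)) \<longlongrightarrow> c) at_top"
proof -
  let ?\<pi> = "\<lambda>x. \<P>(\<omega> in M. X 0 \<omega> = x)"
  have ev: "{\<omega>\<in>space M. X t \<omega> = z} \<in> events" if "0 \<le> t" "z \<in> S" for t z
  proof -
    have "X t -` {z} \<inter> space M \<in> events"
      using that by (intro measurable_sets[OF measurable_process]) auto
    moreover have "{\<omega>\<in>space M. X t \<omega> = z} = X t -` {z} \<inter> space M" by auto
    ultimately show ?thesis by simp
  qed
  have init: "integrable (count_space S) ?\<pi>" "(\<integral>x. ?\<pi> x \<partial>count_space S) = 1"
  proof -
    have "{\<omega>\<in>space M. X 0 \<omega> = x} \<inter> space M = {\<omega>\<in>space M. X 0 \<omega> = x}" for x by auto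
    thus "integrable (count_space S) ?\<pi>" "(\<integral>x. ?\<pi> x \<partial>count_space S) = 1"
      using prob_partition[OF countable_states measurable_process[of 0] sets.top]
      by (simp_all add: prob_space)
  qed
  have law: "\<P>(\<omega> in M. X t \<omega> = y) = (\<integral>x. ?\<pi> x * P t x y \<partial>count_space S)" if t: "0 < t" for t
  proof -
    have "prob ({\<omega>\<in>space M. X 0 \<omega> = x} \<inter> {\<omega>\<in>space M. X t \<omega> = y}) = ?\<pi> x * P t x y" if x: "x \<in> S" for x
    proof (cases "?\<pi> x = 0")
      case True
      have "prob ({\<omega>\<in>space M. X 0 \<omega> = x} \<inter> {\<omega>\<in>space M. X t \<omega> = y}) \<le> ?\<pi> x"
        by (rule finite_measure_mono) (use ev[of 0 x] x in auto)
      thus ?thesis using True measure_nonneg[of M] by (simp add: antisym)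
    next
      case False
      have "{\<omega>\<in>space M. X 0 \<omega> = x} \<inter> {\<omega>\<in>space M. X t \<omega> = y} = {\<omega>\<in>space M. X t \<omega> = y \<and> X 0 \<omega> = x}"
        by auto
      thus ?thesis using step[OF t x False] False by (simp add: cond_prob_def field_simps)
    qed
    hence "(\<integral>x. prob ({\<omega>\<in>space M. X 0 \<omega> = x} \<inter> {\<omega>\<in>space M. X t \<omega> = y}) \<partial>count_space S) =
        (\<integral>x. ?\<pi> x * P t x y \<partial>count_space S)"
      by (intro Bochner_Integration.integral_cong) auto
    moreover have "(\<integral>x. prob ({\<omega>\<in>space M. X 0 \<omega> = x} \<inter> {\<omega>\<in>space M. X t \<omega> = y}) \<partial>count_space S) =
        \<P>(\<omega> in M. X t \<omega> = y)"
      using t y by (intro prob_partition countable_states measurable_process ev) auto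
    ultimately show ?thesis by simp
  qed
  have "((\<lambda>t. \<integral>x. ?\<pi> x * P t x y \<partial>count_space S) \<longlongrightarrow> (\<integral>x. ?\<pi> x * c \<partial>count_space S)) at_top"
  proof (rule integral_dominated_convergence_at_top[where w = ?\<pi>])
    show "AE x in count_space S. ((\<lambda>t. ?\<pi> x * P t x y) \<longlongrightarrow> ?\<pi> x * c) at_top"
      by (auto simp: AE_count_space intro!: tendsto_intros lim)
    show "\<forall>\<^sub>F t in at_top. AE x in count_space S. norm (?\<pi> x * P t x y) \<le> ?\<pi> x"
      using eventually_ge_at_top[of 0]
    proof eventually_elim
      case (elim t)
      show ?case
        using transition_function_bounds[OF P _ y elim]
        by (auto simp: AE_count_space abs_mult intro!: mult_left_le)
    qed
  qed (use init in auto)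
  also have "(\<integral>x. ?\<pi> x * c \<partial>count_space S) = c"
    by (simp add: init)
  finally show ?thesis
    by (rule Lim_transform_eventually)
       (use eventually_gt_at_top[of "0 :: real"] in \<open>eventually_elim, simp add: law\<close>)
qed

section \<open>Transitions of the priority queue\<close>

fun arrival\<^sub>1 :: "state \<Rightarrow> state" where
  "arrival\<^sub>1 (i, j, k) = (if k = 0 then (1, 0, 1) else (i + 1, j, k))"

fun arrival\<^sub>2 :: "state \<Rightarrow> state" where
  "arrival\<^sub>2 (i, j, k) = (if k = 0 then (0, 1, 2) else (i, j + 1, k))"

text \<open>In the empty state an event of the uniformized service process is fictitious and changes nothing.\<close>

fun service_end :: "state \<Rightarrow> state" where
  "service_end (i, j, k) =
     (if k = 0 then (i, j, k)
      else if k = 1 then (i - 1, j, next_service (i - 1) j)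
      else (i, j - 1, next_service i (j - 1)))"

fun population :: "state \<Rightarrow> nat" where
  "population (i, j, k) = i + j"

lemma empty_in_states: "(0, 0, 0) \<in> priority_states"
  by (simp add: priority_states_def)

lemma priority_states_cases [consumes 1, case_names empty class_1 class_2]:
  assumes "x \<in> priority_states"
  obtains "x = (0, 0, 0)"
  | i j where "x = (Suc i, j, 1)"
  | i j where "x = (i, Suc j, 2)"
proof -
  from assms consider "x = (0, 0, 0)" | i j where "x = (i, j, 1)" "1 \<le> i"
    | i j where "x = (i, j, 2)" "1 \<le> j"
    unfolding priority_states_def by blast
  thus ?thesis
  proof cases
    case (2 i j)
    thus ?thesis using that(2)[of "i - 1" j] by simp
  next
    case (3 i j)
    thus ?thesis using that(3)[of i "j - 1"] by simp
  qed (use that in blast)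
qed

lemma transitions_in_states:
  assumes "x \<in> priority_states"
  shows "arrival\<^sub>1 x \<in> priority_states" "arrival\<^sub>2 x \<in> priority_states"
        "service_end x \<in> priority_states"
  using assms
  by (cases rule: priority_states_cases; force simp: priority_states_def next_service_def)+

lemma population_transitions:
  assumes "x \<in> priority_states"
  shows "population (arrival\<^sub>1 x) = population x + 1"
        "population (arrival\<^sub>2 x) = population x + 1"
        "population (service_end x) = population x - 1"
  using assms by (cases rule: priority_states_cases; simp)+

lemma population_eq_0_iff: "x \<in> priority_states \<Longrightarrow> population x = 0 \<longleftrightarrow> x = (0, 0, 0)"
  by (cases rule: priority_states_cases) auto

section \<open>The total number of customers\<close>

locale jump_chain =
  fixes a\<^sub>1 a\<^sub>2 b :: real
  assumes pos: "0 < a\<^sub>1" "0 < a\<^sub>2" "0 < b"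
    and total: "a\<^sub>1 + a\<^sub>2 + b = 1"
    and stable: "a\<^sub>1 + a\<^sub>2 < b"
begin

abbreviation "\<rho> \<equiv> (a\<^sub>1 + a\<^sub>2) / b"

lemma rho: "0 < \<rho>" "\<rho> < 1"
  using pos stable by auto

text \<open>One-step expectation for the total number of customers. The truncated subtraction is the
reflection at 0.\<close>

definition walk :: "(nat \<Rightarrow> real) \<Rightarrow> nat \<Rightarrow> real" where
  "walk g m = (a\<^sub>1 + a\<^sub>2) * g (m + 1) + b * g (m - 1)"

text \<open>The probability that at least \<open>k\<close> customers are present after \<open>n\<close> steps from \<open>m\<close> customers.\<close>

definition tail :: "nat \<Rightarrow> nat \<Rightarrow> nat \<Rightarrow> real" where
  "tail n m k = (walk ^^ n) (\<lambda>m. of_bool (k \<le> m)) m"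

lemma walk_iter_linear:
  "(walk ^^ n) (\<lambda>m. c * f m + d * g m) = (\<lambda>m. c * (walk ^^ n) f m + d * (walk ^^ n) g m)"
  by (induction n) (auto simp: walk_def algebra_simps)

lemma tail_0 [simp]: "tail 0 m k = of_bool (k \<le> m)"
  by (simp add: tail_def)

lemma tail_backward: "tail (Suc n) m k = (a\<^sub>1 + a\<^sub>2) * tail n (m + 1) k + b * tail n (m - 1) k"
  by (simp add: tail_def walk_def)

lemma tail_forward:
  "tail (Suc n) m (Suc k) = (a\<^sub>1 + a\<^sub>2) * tail n m k + b * tail n m (Suc (Suc k))"
proof -
  have "walk (\<lambda>m. of_bool (Suc k \<le> m)) =
        (\<lambda>m. (a\<^sub>1 + a\<^sub>2) * of_bool (k \<le> m) + b * of_bool (Suc (Suc k) \<le> m))"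
    by (auto simp: walk_def fun_eq_iff)
  thus ?thesis
    by (simp add: tail_def funpow_swap1 walk_iter_linear del: funpow.simps add: funpow_Suc_right)
qed

lemma tail_level_0 [simp]: "tail n m 0 = 1"
  by (induction n arbitrary: m) (use total in \<open>auto simp: tail_backward\<close>)

lemma tail_nonneg: "0 \<le> tail n m k"
  by (induction n arbitrary: m) (use pos in \<open>auto simp: tail_backward\<close>)

text \<open>The right-hand side solves the forward equation at positive levels and dominates the initial tail.\<close>

lemma tail_bound: "tail n m k \<le> \<rho> ^ k / \<rho> ^ m"
proof (induction n arbitrary: k)
  case 0
  show ?case using rho by (auto intro!: power_decreasing simp: pos)
next
  case (Suc n)
  show ?case
  proof (cases k)
    case 0
    show ?thesis using rho by (auto simp: 0 power_le_one)
  next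
    case (Suc k')
    have "tail (Suc n) m k \<le> (a\<^sub>1 + a\<^sub>2) * (\<rho> ^ k' / \<rho> ^ m) + b * (\<rho> ^ Suc (Suc k') / \<rho> ^ m)"
      unfolding Suc tail_forward using pos by (intro add_mono mult_left_mono Suc.IH) auto
    also have "\<dots> = \<rho> ^ k / \<rho> ^ m"
    proof -
      have "b * r * (r ^ k' / c) + b * (r ^ Suc (Suc k') / c) = (b * r + b) * (r ^ k / c)" for r c
        by (simp add: Suc algebra_simps add_divide_distrib)
      from this[of \<rho> "\<rho> ^ m"] show ?thesis
        using pos total by simp
    qed
    finally show ?thesis .
  qed
qed

text \<open>Started from its smallest state, the walk is stochastically increasing in time.\<close>

lemma tail_from_empty_mono: "tail n 0 k \<le> tail (Suc n) 0 k"
proof (induction n arbitrary: k)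
  case 0
  show ?case by (cases "k = 0") (auto simp: tail_nonneg)
next
  case (Suc n)
  show ?case
  proof (cases k)
    case (Suc k')
    show ?thesis unfolding Suc tail_forward[of "Suc n" 0 k'] tail_forward[of n 0 k']
      using pos by (intro add_mono mult_left_mono Suc.IH) auto
  qed simp
qed

text \<open>From 0 the tails converge by monotonicity, and their limit is identified by its balance
equations. The backward equation at \<open>m\<close> expresses the tail from \<open>m + 1\<close> through those from
\<open>m\<close> and \<open>m - 1\<close>, which carries the limit to every other starting point.\<close>

lemma tail_limit: "(\<lambda>n. tail n m k) \<longlonglongrightarrow> \<rho> ^ k"
proof (induction m rule: less_induct)
  case (less m)
  show ?case
  proof (cases m)
    case 0
    have "\<exists>L. (\<lambda>n. tail n 0 k) \<longlonglongrightarrow> L" for k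
      using incseq_convergent[of "\<lambda>n. tail n 0 k"] tail_from_empty_mono tail_bound[of _ 0 k]
      by (metis incseq_SucI)
    then obtain T where T: "\<And>k. (\<lambda>n. tail n 0 k) \<longlonglongrightarrow> T k" by metis
    have "T k = \<rho> ^ k"
    proof (rule geometric_if_balanced)
      show "T 0 = 1" using LIMSEQ_unique[OF T[of 0]] by simp
      have le: "T k \<le> \<rho> ^ k" "0 \<le> T k" for k
        using LIMSEQ_le_const2[OF T[of k]] LIMSEQ_le_const[OF T[of k]]
              tail_bound[of _ 0 k] tail_nonneg by auto
      have "(\<lambda>k. \<rho> ^ k) \<longlonglongrightarrow> 0" using rho by (intro LIMSEQ_realpow_zero) auto
      thus "T \<longlonglongrightarrow> 0"
        using le by (intro tendsto_sandwich[of "\<lambda>_. 0" T sequentially "\<lambda>k. \<rho> ^ k"]) auto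
    next
      fix k
      have "(\<lambda>n. tail (Suc n) 0 (Suc k)) \<longlonglongrightarrow> (a\<^sub>1 + a\<^sub>2) * T k + b * T (Suc (Suc k))"
        unfolding tail_forward by (intro tendsto_intros T)
      from LIMSEQ_unique[OF this LIMSEQ_Suc[OF T]]
      show "(a\<^sub>1 + a\<^sub>2 + b) * T (Suc k) = (a\<^sub>1 + a\<^sub>2) * T k + b * T (Suc (Suc k))"
        by (simp add: total)
    qed (use pos stable in auto)
    thus ?thesis using T[of k] 0 by simp
  next
    case (Suc m')
    have eq: "tail n m k = (tail (Suc n) m' k - b * tail n (m' - 1) k) / (a\<^sub>1 + a\<^sub>2)" for n
      using pos by (simp add: Suc tail_backward)
    have "(\<lambda>n. tail n m k) \<longlonglongrightarrow> (\<rho> ^ k - b * \<rho> ^ k) / (a\<^sub>1 + a\<^sub>2)"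
      unfolding eq using Suc pos
      by (intro tendsto_intros LIMSEQ_Suc[OF less.IH] less.IH) auto
    also have "\<rho> ^ k - b * \<rho> ^ k = (a\<^sub>1 + a\<^sub>2) * \<rho> ^ k"
    proof -
      have "a\<^sub>1 + a\<^sub>2 = 1 - b" using total by simp
      thus ?thesis by (simp only: left_diff_distrib mult_1)
    qed
    finally show ?thesis using pos by simp
  qed
qed

section \<open>The jump chain\<close>

text \<open>The transition operator of the jump chain, acting on functions; \<open>(jump ^^ n) f x\<close> is the
expectation of \<open>f\<close> after \<open>n\<close> steps from \<open>x\<close>.\<close>

definition jump :: "(state \<Rightarrow> real) \<Rightarrow> state \<Rightarrow> real" where
  "jump f x = a\<^sub>1 * f (arrival\<^sub>1 x) + a\<^sub>2 * f (arrival\<^sub>2 x) + b * f (service_end x)"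

lemma jump_mono:
  assumes "\<And>y. y \<in> priority_states \<Longrightarrow> f y \<le> g y" "x \<in> priority_states"
  shows "jump f x \<le> jump g x"
  unfolding jump_def using assms pos
  by (intro add_mono mult_left_mono) (auto simp: transitions_in_states)

lemma jump_cong:
  assumes "\<And>y. y \<in> priority_states \<Longrightarrow> f y = g y" "x \<in> priority_states"
  shows "jump f x = jump g x"
  using assms by (simp add: jump_def transitions_in_states)

lemma abs_jump_le: "\<bar>jump f x\<bar> \<le> jump (\<lambda>y. \<bar>f y\<bar>) x"
  unfolding jump_def
  by (rule order_trans[OF abs_triangle_ineq] add_mono)+ (use pos in \<open>simp_all add: abs_mult\<close>)

lemma jump_iter_mono:
  assumes "\<And>y. y \<in> priority_states \<Longrightarrow> f y \<le> g y" "x \<in> priority_states"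
  shows "(jump ^^ n) f x \<le> (jump ^^ n) g x"
  using assms(2) by (induction n arbitrary: x) (auto intro!: jump_mono assms(1))

lemma jump_iter_cong:
  assumes "\<And>y. y \<in> priority_states \<Longrightarrow> f y = g y" "x \<in> priority_states"
  shows "(jump ^^ n) f x = (jump ^^ n) g x"
  by (intro antisym jump_iter_mono) (use assms in auto)

lemma jump_iter_linear:
  "(jump ^^ n) (\<lambda>x. c * f x + d * g x) = (\<lambda>x. c * (jump ^^ n) f x + d * (jump ^^ n) g x)"
  by (induction n) (auto simp: jump_def algebra_simps)

lemma jump_iter_sum: "(jump ^^ n) (\<lambda>x. \<Sum>i\<in>I. f i x) = (\<lambda>x. \<Sum>i\<in>I. (jump ^^ n) (f i) x)"
  by (induction n) (auto simp: jump_def sum_distrib_left sum.distrib)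

lemma jump_iter_const: "(jump ^^ n) (\<lambda>_. c) = (\<lambda>_. c)"
proof (induction n)
  case (Suc n)
  have "(a\<^sub>1 + a\<^sub>2 + b) * c = c" by (simp only: total mult_1)
  with Suc show ?case by (simp add: jump_def algebra_simps fun_eq_iff)
qed simp

lemma jump_iter_bound:
  assumes "\<And>y. y \<in> priority_states \<Longrightarrow> \<bar>f y\<bar> \<le> B" "x \<in> priority_states"
  shows "\<bar>(jump ^^ n) f x\<bar> \<le> B"
proof -
  have "(jump ^^ n) f x \<le> (jump ^^ n) (\<lambda>_. B) x" "(jump ^^ n) (\<lambda>_. - B) x \<le> (jump ^^ n) f x"
    using assms by (auto intro!: jump_iter_mono simp: abs_le_iff minus_le_iff)
  thus ?thesis by (simp add: jump_iter_const)
qed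

text \<open>The completion rate does not depend on the class in service, so the population is itself a Markov
chain.\<close>

lemma jump_iter_population:
  assumes "x \<in> priority_states"
  shows "(jump ^^ n) (\<lambda>x. g (population x)) x = (walk ^^ n) g (population x)"
  using assms
proof (induction n arbitrary: x)
  case (Suc n)
  have "jump ((jump ^^ n) (\<lambda>x. g (population x))) x = jump (\<lambda>x. (walk ^^ n) g (population x)) x"
    by (rule jump_cong) (use Suc in auto)
  also have "\<dots> = walk ((walk ^^ n) g) (population x)"
    using Suc.prems by (simp add: jump_def walk_def population_transitions algebra_simps)
  finally show ?case by simp
qed simp

lemma jump_iter_tail:
  "x \<in> priority_states \<Longrightarrow>
   (jump ^^ n) (\<lambda>x. of_bool (k \<le> population x)) x = tail n (population x) k"
  unfolding tail_def by (rule jump_iter_population)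

definition at_empty :: "state \<Rightarrow> real" where
  "at_empty x = of_bool (x = (0, 0, 0))"

lemma at_empty_simps: "at_empty (0, 0, 0) = 1" "x \<noteq> (0, 0, 0) \<Longrightarrow> at_empty x = 0" "\<bar>at_empty x\<bar> \<le> 1"
  by (simp_all add: at_empty_def)

lemma at_empty_limit:
  assumes "x \<in> priority_states"
  shows "(\<lambda>n. (jump ^^ n) at_empty x) \<longlonglongrightarrow> 1 - \<rho>"
proof -
  have "(jump ^^ n) at_empty x = 1 - tail n (population x) 1" for n
  proof -
    have "(jump ^^ n) at_empty x = (jump ^^ n) (\<lambda>x. 1 * 1 + (- 1) * of_bool (1 \<le> population x)) x"
    proof -
      have "at_empty y = 1 * 1 + (- 1) * of_bool (1 \<le> population y)" if "y \<in> priority_states" for y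
        using population_eq_0_iff[OF that] by (auto simp: at_empty_def Suc_le_eq)
      thus ?thesis by (intro antisym jump_iter_mono assms) simp_all
    qed
    thus ?thesis unfolding jump_iter_linear jump_iter_const jump_iter_tail[OF assms] by simp
  qed
  thus ?thesis using tendsto_diff[OF tendsto_const tail_limit[of "population x" 1], of 1] by simp
qed

section \<open>Convergence of the jump chain by decomposition at the last visit to the empty state\<close>

text \<open>The expectation of \<open>f\<close> after \<open>r\<close> steps on the event that the first \<open>r\<close> positions of the
path (all but the last) avoid the empty state.\<close>

primrec taboo :: "(state \<Rightarrow> real) \<Rightarrow> nat \<Rightarrow> state \<Rightarrow> real" where
  "taboo f 0 = f"
| "taboo f (Suc r) = (\<lambda>x. if x = (0, 0, 0) then 0 else jump (taboo f r) x)"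

text \<open>Paths are split according to the step \<open>n - Suc r\<close> of the last visit to the empty state before
time \<open>n\<close>; the first summand belongs to the paths without such a visit.\<close>

lemma last_exit_decomposition:
  "(jump ^^ n) f x =
     taboo f n x + (\<Sum>r<n. jump (taboo f r) (0, 0, 0) * (jump ^^ (n - Suc r)) at_empty x)"
proof (induction n arbitrary: x)
  case (Suc n)
  have "(jump ^^ Suc n) f x = jump (\<lambda>x. taboo f n x +
      (\<Sum>r<n. jump (taboo f r) (0, 0, 0) * (jump ^^ (n - Suc r)) at_empty x)) x"
    unfolding Suc[abs_def, symmetric] by simp
  also have "\<dots> = jump (taboo f n) x +
      (\<Sum>r<n. jump (taboo f r) (0, 0, 0) * jump ((jump ^^ (n - Suc r)) at_empty) x)"
    by (simp add: jump_def sum_distrib_left sum.distrib distrib_left mult.left_commute)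
  also have "(\<Sum>r<n. jump (taboo f r) (0, 0, 0) * jump ((jump ^^ (n - Suc r)) at_empty) x) =
      (\<Sum>r<n. jump (taboo f r) (0, 0, 0) * (jump ^^ (Suc n - Suc r)) at_empty x)"
  proof (intro sum.cong refl)
    fix r assume "r \<in> {..<n}"
    hence "Suc n - Suc r = Suc (n - Suc r)" by auto
    thus "jump (taboo f r) (0, 0, 0) * jump ((jump ^^ (n - Suc r)) at_empty) x =
      jump (taboo f r) (0, 0, 0) * (jump ^^ (Suc n - Suc r)) at_empty x" by (simp only: funpow.simps o_def)
  qed
  finally show ?case
    by (cases "x = (0, 0, 0)") (simp_all add: at_empty_simps)
qed simp

text \<open>Off the empty state the population decreases by \<open>b - (a\<^sub>1 + a\<^sub>2)\<close> per step on average, so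
\<open>population x / (b - (a\<^sub>1 + a\<^sub>2))\<close> bounds the mean time to reach the empty state. The induction
uses it as a Lyapunov function.\<close>

lemma taboo_sum_bound:
  assumes f: "\<And>y. y \<in> priority_states \<Longrightarrow> \<bar>f y\<bar> \<le> B" "f (0, 0, 0) = 0"
    and x: "x \<in> priority_states"
  shows "(\<Sum>r<n. \<bar>taboo f r x\<bar>) \<le> B * population x / (b - (a\<^sub>1 + a\<^sub>2))"
  using x
proof (induction n arbitrary: x)
  case 0
  have "0 \<le> B" using f(1)[OF empty_in_states] by simp
  thus ?case using stable by simp
next
  case (Suc n)
  let ?V = "\<lambda>x. B * real (population x) / (b - (a\<^sub>1 + a\<^sub>2))"
  show ?case
  proof (cases "x = (0, 0, 0)")
    case True
    have "taboo f r (0, 0, 0) = 0" for r using f(2) by (cases r) auto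
    thus ?thesis by (simp add: True)
  next
    case False
    hence pop: "1 \<le> population x" using population_eq_0_iff[OF Suc.prems] by linarith
    have "(\<Sum>r<Suc n. \<bar>taboo f r x\<bar>) = \<bar>f x\<bar> + (\<Sum>r<n. \<bar>jump (taboo f r) x\<bar>)"
      using False by (simp add: sum.lessThan_Suc_shift del: sum.lessThan_Suc)
    also have "\<dots> \<le> B + (\<Sum>r<n. jump (\<lambda>y. \<bar>taboo f r y\<bar>) x)"
      by (intro add_mono sum_mono f abs_jump_le Suc.prems)
    also have "(\<Sum>r<n. jump (\<lambda>y. \<bar>taboo f r y\<bar>) x) = jump (\<lambda>y. \<Sum>r<n. \<bar>taboo f r y\<bar>) x"
      by (simp add: jump_def sum_distrib_left sum.distrib)
    also have "\<dots> \<le> jump ?V x"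
      by (rule jump_mono) (use Suc in auto)
    also have "B + jump ?V x = ?V x"
    proof -
      have "jump ?V x = B * ((a\<^sub>1 + a\<^sub>2) * (real (population x) + 1) + b * (real (population x) - 1))
              / (b - (a\<^sub>1 + a\<^sub>2))"
      proof -
        have "a\<^sub>1 * (B * u / D) + a\<^sub>2 * (B * u / D) + b * (B * w / D) = B * ((a\<^sub>1 + a\<^sub>2) * u + b * w) / D"
          for u w D :: real
          by (simp add: add_divide_distrib algebra_simps)
        thus ?thesis
          using pop Suc.prems by (simp add: jump_def population_transitions of_nat_diff add.commute)
      qed
      also have "(a\<^sub>1 + a\<^sub>2) * (real (population x) + 1) + b * (real (population x) - 1) =
          (a\<^sub>1 + a\<^sub>2 + b) * population x - (b - (a\<^sub>1 + a\<^sub>2))"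
        by (simp add: algebra_simps)
      moreover have "B + B * (1 * p - D) / D = B * p / D" if "D \<noteq> 0" for p D :: real
        using that by (simp add: field_simps)
      ultimately show ?thesis using stable by (simp add: total)
    qed
    finally show ?thesis by simp
  qed
qed

lemma jump_iter_converges_if_0_at_empty:
  assumes f: "\<And>y. y \<in> priority_states \<Longrightarrow> \<bar>f y\<bar> \<le> B" "f (0, 0, 0) = 0"
    and x: "x \<in> priority_states"
  shows "(\<lambda>n. (jump ^^ n) f x) \<longlonglongrightarrow> (\<Sum>r. jump (taboo f r) (0, 0, 0) * (1 - \<rho>))"
proof -
  have summ: "summable (\<lambda>r. \<bar>taboo f r y\<bar>)" if "y \<in> priority_states" for y
    using taboo_sum_bound[of f B y] f that by (intro bounded_imp_summable[of _ "B * population y / (b - (a\<^sub>1 + a\<^sub>2))"])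
       (auto simp: lessThan_Suc_atMost[symmetric] simp del: sum.lessThan_Suc)
  have "summable (\<lambda>r. a\<^sub>1 * \<bar>taboo f r (arrival\<^sub>1 (0,0,0))\<bar> + a\<^sub>2 * \<bar>taboo f r (arrival\<^sub>2 (0,0,0))\<bar> +
          b * \<bar>taboo f r (service_end (0,0,0))\<bar>)"
    by (intro summable_add summable_mult summ transitions_in_states empty_in_states)
  hence "summable (\<lambda>r. \<bar>jump (taboo f r) (0, 0, 0)\<bar>)"
  proof (rule summable_comparison_test'[of _ 0])
    fix r :: nat
    show "norm \<bar>jump (taboo f r) (0, 0, 0)\<bar> \<le> a\<^sub>1 * \<bar>taboo f r (arrival\<^sub>1 (0,0,0))\<bar> +
      a\<^sub>2 * \<bar>taboo f r (arrival\<^sub>2 (0,0,0))\<bar> + b * \<bar>taboo f r (service_end (0,0,0))\<bar>"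
      using abs_jump_le[of "taboo f r" "(0, 0, 0)"] by (simp add: jump_def)
  qed
  hence "(\<lambda>n. \<Sum>r<n. jump (taboo f r) (0, 0, 0) * (jump ^^ (n - Suc r)) at_empty x)
     \<longlonglongrightarrow> (\<Sum>r. jump (taboo f r) (0, 0, 0) * (1 - \<rho>))"
    by (rule convolution_limit)
       (use x in \<open>auto intro!: jump_iter_bound at_empty_limit at_empty_simps(3)\<close>)
  moreover have "(\<lambda>n. taboo f n x) \<longlonglongrightarrow> 0"
    using summable_LIMSEQ_zero[OF summ[OF x]] by (simp add: tendsto_rabs_zero_iff)
  ultimately show ?thesis
    unfolding last_exit_decomposition[of _ f] using tendsto_add[where a = 0] by force
qed

lemma jump_iter_converges:
  assumes "bounded (f ` priority_states)"
  shows "\<exists>L. \<forall>x\<in>priority_states. (\<lambda>n. (jump ^^ n) f x) \<longlonglongrightarrow> L"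
proof -
  obtain B where B: "\<And>x. x \<in> priority_states \<Longrightarrow> \<bar>f x\<bar> \<le> B"
    using assms by (auto simp: bounded_iff)
  define c where "c = f (0, 0, 0)"
  \<comment> \<open>Subtracting a multiple of \<open>at_empty\<close>, whose iterates are known to converge, makes \<open>f\<close> vanish at the empty state.\<close>
  define g where "g x = f x - c * at_empty x" for x
  have "\<bar>g x\<bar> \<le> 2 * B" if "x \<in> priority_states" for x
  proof -
    have "\<bar>g x\<bar> \<le> \<bar>f x\<bar> + \<bar>c\<bar> * \<bar>at_empty x\<bar>"
      unfolding g_def abs_mult[symmetric] by (rule abs_triangle_ineq4)
    also have "\<dots> \<le> B + B * 1"
      using B[OF that] B[OF empty_in_states] at_empty_simps(3)[of x]
      by (intro add_mono mult_mono) (auto simp: c_def)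
    finally show ?thesis by simp
  qed
  moreover have "g (0, 0, 0) = 0" by (simp add: g_def c_def at_empty_simps)
  ultimately obtain L where L: "\<And>x. x \<in> priority_states \<Longrightarrow> (\<lambda>n. (jump ^^ n) g x) \<longlonglongrightarrow> L"
    using jump_iter_converges_if_0_at_empty[of g "2 * B"] by metis
  have f: "f = (\<lambda>x. 1 * g x + c * at_empty x)" by (simp add: g_def)
  have "(\<lambda>n. (jump ^^ n) f x) \<longlonglongrightarrow> 1 * L + c * (1 - \<rho>)" if "x \<in> priority_states" for x
    unfolding f jump_iter_linear by (intro tendsto_intros L at_empty_limit that)
  thus ?thesis by blast
qed

section \<open>The equilibrium functional\<close>

definition equilibrium :: "(state \<Rightarrow> real) \<Rightarrow> real" where
  "equilibrium f = lim (\<lambda>n. (jump ^^ n) f (0, 0, 0))"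

lemma equilibrium:
  assumes "bounded (f ` priority_states)" "x \<in> priority_states"
  shows "(\<lambda>n. (jump ^^ n) f x) \<longlonglongrightarrow> equilibrium f"
proof -
  obtain L where L: "\<forall>x\<in>priority_states. (\<lambda>n. (jump ^^ n) f x) \<longlonglongrightarrow> L"
    using jump_iter_converges[OF assms(1)] by blast
  moreover from this have "equilibrium f = L"
    unfolding equilibrium_def using empty_in_states by (intro limI) auto
  ultimately show ?thesis using assms(2) by simp
qed

lemma equilibrium_cong:
  assumes "\<And>x. x \<in> priority_states \<Longrightarrow> f x = g x"
  shows "equilibrium f = equilibrium g"
  unfolding equilibrium_def by (intro arg_cong[where f = lim] ext jump_iter_cong assms empty_in_states)

lemma equilibrium_linear:
  assumes "bounded (f ` priority_states)" "bounded (g ` priority_states)"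
  shows "equilibrium (\<lambda>x. c * f x + d * g x) = c * equilibrium f + d * equilibrium g"
proof (rule LIMSEQ_unique)
  show "(\<lambda>n. (jump ^^ n) (\<lambda>x. c * f x + d * g x) (0, 0, 0)) \<longlonglongrightarrow>
          equilibrium (\<lambda>x. c * f x + d * g x)"
    by (intro equilibrium bounded_linear_combination assms empty_in_states)
  show "(\<lambda>n. (jump ^^ n) (\<lambda>x. c * f x + d * g x) (0, 0, 0)) \<longlonglongrightarrow>
          c * equilibrium f + d * equilibrium g"
    unfolding jump_iter_linear by (intro tendsto_intros equilibrium assms empty_in_states)
qed

lemma equilibrium_mono:
  assumes "bounded (f ` priority_states)" "bounded (g ` priority_states)"
    and "\<And>x. x \<in> priority_states \<Longrightarrow> f x \<le> g x"
  shows "equilibrium f \<le> equilibrium g"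
  by (rule LIMSEQ_le[OF equilibrium[OF assms(1)] equilibrium[OF assms(2)]])
     (auto intro!: empty_in_states jump_iter_mono assms(3))

lemma equilibrium_const: "equilibrium (\<lambda>_. c) = c"
  by (simp add: equilibrium_def jump_iter_const)

lemma equilibrium_jump:
  assumes "bounded (f ` priority_states)"
  shows "equilibrium (jump f) = equilibrium f"
proof -
  have "(\<lambda>n. (jump ^^ n) (jump f) (0, 0, 0)) \<longlonglongrightarrow> equilibrium f"
    using LIMSEQ_Suc[OF equilibrium[OF assms empty_in_states]]
    by (simp add: funpow_Suc_right del: funpow.simps)
  thus ?thesis unfolding equilibrium_def[of "jump f"] by (rule limI)
qed

lemma equilibrium_tail: "equilibrium (\<lambda>x. of_bool (k \<le> population x)) = \<rho> ^ k"
proof -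
  have "(\<lambda>n. (jump ^^ n) (\<lambda>x. of_bool (k \<le> population x)) (0, 0, 0)) \<longlonglongrightarrow> \<rho> ^ k"
    unfolding jump_iter_tail[OF empty_in_states] by (rule tail_limit)
  thus ?thesis unfolding equilibrium_def by (rule limI)
qed

lemma equilibrium_empty: "equilibrium (\<lambda>x. of_bool (x = (0, 0, 0))) = 1 - \<rho>"
proof -
  have "(\<lambda>n. (jump ^^ n) at_empty (0, 0, 0)) \<longlonglongrightarrow> 1 - \<rho>"
    by (rule at_empty_limit[OF empty_in_states])
  thus ?thesis unfolding equilibrium_def at_empty_def by (rule limI)
qed

lemma equilibrium_sum:
  assumes "finite F"
  shows "equilibrium (\<lambda>x. of_bool (x \<in> F)) = (\<Sum>y\<in>F. equilibrium (\<lambda>x. of_bool (x = y)))"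
proof -
  have "(\<lambda>x. of_bool (x \<in> F) :: real) = (\<lambda>x. \<Sum>y\<in>F. of_bool (x = y))"
    using assms by (auto simp: of_bool_def)
  hence "(\<lambda>n. (jump ^^ n) (\<lambda>x. of_bool (x \<in> F)) (0, 0, 0)) \<longlonglongrightarrow>
      (\<Sum>y\<in>F. equilibrium (\<lambda>x. of_bool (x = y)))"
    by (simp only: jump_iter_sum) (intro tendsto_sum equilibrium bounded_of_bool empty_in_states)
  thus ?thesis unfolding equilibrium_def[of "\<lambda>x. of_bool (x \<in> F)"] by (rule limI)
qed

text \<open>Invariance is applied to the number of class-1 customers truncated at \<open>m\<close>, which is bounded. It
rises by one at a class-1 arrival below level \<open>m\<close> and falls by one at a class-1 completion from a
level at most \<open>m\<close>; both truncations cost at most a power of \<open>\<rho>\<close>.\<close>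

lemma equilibrium_class_1: "equilibrium (\<lambda>x. of_bool (snd (snd x) = 1)) = a\<^sub>1 / b"
proof -
  define E1 where "E1 = equilibrium (\<lambda>x. of_bool (snd (snd x) = 1))"
  have bounds: "a\<^sub>1 * (1 - \<rho> ^ m) \<le> b * E1" "b * E1 \<le> a\<^sub>1 + b * \<rho> ^ Suc m" for m
  proof -
    define f :: "state \<Rightarrow> real" where "f x = min (real (fst x)) (real m)" for x
    define U D :: "state \<Rightarrow> real"
      where "U x = of_bool (fst x < m)" and "D x = of_bool (snd (snd x) = 1 \<and> fst x \<le> m)" for x
    have bnd: "bounded (f ` priority_states)" "bounded (U ` priority_states)" "bounded (D ` priority_states)"
      unfolding U_def D_def
      subgoal by (auto simp: f_def bounded_iff intro: exI[of _ "real m"])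
      by (rule bounded_of_bool)+
    have drift: "jump f x = 1 * f x + 1 * (a\<^sub>1 * U x + (- b) * D x)" if "x \<in> priority_states" for x
    proof -
      have "jump f x = (a\<^sub>1 + a\<^sub>2 + b) * f x + a\<^sub>1 * (f (arrival\<^sub>1 x) - f x) +
              a\<^sub>2 * (f (arrival\<^sub>2 x) - f x) + b * (f (service_end x) - f x)"
        by (simp add: jump_def algebra_simps)
      moreover have "f (arrival\<^sub>1 x) - f x = U x" "f (arrival\<^sub>2 x) - f x = 0"
        "f (service_end x) - f x = - D x"
        using that by (cases rule: priority_states_cases; force simp: f_def U_def D_def)+
      ultimately show ?thesis by (simp add: total)
    qed
    have bnd': "bounded ((\<lambda>x. a\<^sub>1 * U x + (- b) * D x) ` priority_states)"
      by (intro bounded_linear_combination bnd)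
    have "equilibrium (jump f) = equilibrium (\<lambda>x. 1 * f x + 1 * (a\<^sub>1 * U x + (- b) * D x))"
      by (rule equilibrium_cong[OF drift])
    \<comment> \<open>The increment of \<open>f\<close> has equilibrium value 0.\<close>
    hence balance: "a\<^sub>1 * equilibrium U = b * equilibrium D"
      unfolding equilibrium_jump[OF bnd(1)] equilibrium_linear[OF bnd(1) bnd']
        equilibrium_linear[OF bnd(2,3)] by simp
    have U: "1 - \<rho> ^ m \<le> equilibrium U"
    proof -
      have "equilibrium (\<lambda>x. 1 * 1 + (- 1) * of_bool (m \<le> population x)) \<le> equilibrium U"
        by (rule equilibrium_mono[OF bounded_linear_combination[OF bounded_const_image bounded_of_bool] bnd(2)])
           (auto simp: U_def)
      thus ?thesis
        by (subst (asm) equilibrium_linear)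
           (auto simp: equilibrium_const equilibrium_tail bounded_of_bool bounded_const_image)
    qed
    have U1: "equilibrium U \<le> 1"
      using equilibrium_mono[OF bnd(2) bounded_const_image, of 1] by (auto simp: equilibrium_const U_def)
    have D: "equilibrium D \<le> E1"
      unfolding E1_def by (rule equilibrium_mono) (auto intro!: bounded_of_bool bnd simp: D_def)
    have D1: "E1 \<le> equilibrium D + \<rho> ^ Suc m"
    proof -
      have "E1 \<le> equilibrium (\<lambda>x. 1 * D x + 1 * of_bool (Suc m \<le> population x))"
        unfolding E1_def
        by (rule equilibrium_mono[OF bounded_of_bool bounded_linear_combination[OF bnd(3) bounded_of_bool]])
           (auto simp: D_def)
      thus ?thesis
        by (subst (asm) equilibrium_linear[OF bnd(3) bounded_of_bool])
           (simp add: equilibrium_tail)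
    qed
    show "a\<^sub>1 * (1 - \<rho> ^ m) \<le> b * E1"
      using mult_left_mono[OF U, of "a\<^sub>1"] mult_left_mono[OF D, of b] balance pos by linarith
    show "b * E1 \<le> a\<^sub>1 + b * \<rho> ^ Suc m"
      using mult_left_mono[OF U1, of "a\<^sub>1"] mult_left_mono[OF D1, of b] balance pos
      by (simp add: distrib_left)
  qed
  have lim: "(\<lambda>m. \<rho> ^ m) \<longlonglongrightarrow> 0" using rho by (intro LIMSEQ_realpow_zero) auto
  have "a\<^sub>1 * (1 - 0) \<le> b * E1"
    by (rule LIMSEQ_le_const2[OF tendsto_mult_left[OF tendsto_diff[OF tendsto_const lim]]])
       (use bounds(1) in blast)
  moreover have "b * E1 \<le> a\<^sub>1 + b * 0"
    by (rule LIMSEQ_le_const[OF tendsto_add[OF tendsto_const tendsto_mult_left[OF LIMSEQ_Suc[OF lim]]]])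
       (use bounds(2) in blast)
  ultimately have "b * E1 = a\<^sub>1" by simp
  thus ?thesis using pos by (simp add: E1_def field_simps)
qed

text \<open>The complement of the two events whose equilibrium values are known.\<close>

lemma equilibrium_class_2: "equilibrium (\<lambda>x. of_bool (snd (snd x) = 2)) = a\<^sub>2 / b"
proof -
  let ?E1 = "\<lambda>x :: state. of_bool (snd (snd x) = 1) :: real"
  let ?E0 = "\<lambda>x :: state. of_bool (x = (0, 0, 0)) :: real"
  let ?not0 = "\<lambda>x. 1 * 1 + (- 1) * ?E0 x"
  have bnd: "bounded (?not0 ` priority_states)"
    by (intro bounded_linear_combination bounded_of_bool bounded_const_image)
  have "equilibrium (\<lambda>x. of_bool (snd (snd x) = 2)) = equilibrium (\<lambda>x. 1 * ?not0 x + (- 1) * ?E1 x)"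
    by (rule equilibrium_cong) (auto elim: priority_states_cases)
  also have "\<dots> = (1 - (1 - \<rho>)) - a\<^sub>1 / b"
    using equilibrium_class_1
    by (simp only: equilibrium_linear[OF bnd bounded_of_bool]
          equilibrium_linear[OF bounded_const_image bounded_of_bool] equilibrium_const equilibrium_empty)
       simp
  finally show ?thesis by (simp add: add_divide_distrib)
qed

text \<open>A limit of expectations is in general only finitely additive. Here no mass escapes to infinity:
at most \<open>\<rho> ^ M\<close> of it lies outside the finite set of states with population below \<open>M\<close>.\<close>

lemma equilibrium_has_sum:
  assumes "A \<subseteq> priority_states"
  shows "((\<lambda>y. equilibrium (\<lambda>x. of_bool (x = y))) has_sum equilibrium (\<lambda>x. of_bool (x \<in> A))) A"
proof -
  let ?\<pi> = "\<lambda>y. equilibrium (\<lambda>x. of_bool (x = y))"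
  let ?E = "equilibrium (\<lambda>x. of_bool (x \<in> A))"
  have nonneg: "0 \<le> ?\<pi> y" for y
    using equilibrium_mono[of "\<lambda>_. 0" "\<lambda>x. of_bool (x = y)"]
    by (auto simp: equilibrium_const bounded_of_bool bounded_const_image)
  have upper: "sum ?\<pi> F \<le> ?E" if "finite F" "F \<subseteq> A" for F
    unfolding equilibrium_sum[OF that(1), symmetric]
    by (rule equilibrium_mono) (use that in \<open>auto intro: bounded_of_bool\<close>)
  have summ: "?\<pi> summable_on A"
    by (rule nonneg_bdd_above_summable_on) (use nonneg upper in \<open>auto intro!: bdd_aboveI\<close>)
  have lower: "?E \<le> infsum ?\<pi> A + \<rho> ^ M" for M
  proof -
    define F where "F = {y \<in> A. population y < M}"
    have F: "finite F" "F \<subseteq> A"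
    proof -
      have "F \<subseteq> {..M} \<times> {..M} \<times> {..2}"
        using assms by (auto simp: F_def priority_states_def)
      thus "finite F" by (rule finite_subset) auto
    qed (auto simp: F_def)
    have "?E \<le> equilibrium (\<lambda>x. 1 * of_bool (x \<in> F) + 1 * of_bool (M \<le> population x))"
      by (rule equilibrium_mono[OF bounded_of_bool bounded_linear_combination[OF bounded_of_bool bounded_of_bool]])
         (auto simp: F_def)
    also have "\<dots> = sum ?\<pi> F + \<rho> ^ M"
      by (subst equilibrium_linear)
         (auto simp: bounded_of_bool equilibrium_tail equilibrium_sum[OF F(1)])
    also have "sum ?\<pi> F \<le> infsum ?\<pi> A"
      by (rule finite_sum_le_infsum[OF summ F]) (use nonneg in auto)
    finally show ?thesis by simp
  qed
  have "(\<lambda>M. infsum ?\<pi> A + \<rho> ^ M) \<longlonglongrightarrow> infsum ?\<pi> A + 0"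
    using rho by (intro tendsto_intros LIMSEQ_realpow_zero) auto
  hence "?E \<le> infsum ?\<pi> A" using lower by (auto intro: LIMSEQ_le_const)
  moreover have "infsum ?\<pi> A \<le> ?E"
    using summ upper by (rule infsum_le_finite_sums)
  ultimately show ?thesis using has_sum_infsum[OF summ] by simp
qed

section \<open>Uniformization\<close>

lemma jump_sub_sum:
  "jump (\<lambda>x. c * f x - (\<Sum>k\<in>I. d k * g k x)) x = c * jump f x - (\<Sum>k\<in>I. d k * jump (g k) x)"
  by (simp add: jump_def algebra_simps sum_distrib_left sum.distrib)

text \<open>Multiplying by \<open>exp (L * t)\<close> removes the diagonal term of the backward equation. The remainder after
\<open>n\<close> terms of the exponential series then has as its derivative \<open>L\<close> times \<open>jump\<close> applied to the
preceding remainder; as \<open>jump\<close> does not increase bounds, integrating \<open>n\<close> times bounds it by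
the \<open>n\<close>-th exponential term.\<close>

lemma uniformization:
  fixes u :: "real \<Rightarrow> state \<Rightarrow> real"
  assumes L: "0 < L"
    and u: "\<And>t x. 0 \<le> t \<Longrightarrow> x \<in> priority_states \<Longrightarrow> \<bar>u t x\<bar> \<le> 1"
    and u': "\<And>t x. 0 \<le> t \<Longrightarrow> x \<in> priority_states \<Longrightarrow>
          ((\<lambda>s. u s x) has_real_derivative L * (jump (u t) x - u t x)) (at t within {0..})"
    and t: "0 \<le> t" and x: "x \<in> priority_states"
  shows "(\<lambda>n. (L * t) ^ n / fact n * (jump ^^ n) (u 0) x) sums (exp (L * t) * u t x)"
proof -
  define G where "G n s x = exp (L * s) * u s x -
    (\<Sum>k<n. (L * s) ^ k / fact k * (jump ^^ k) (u 0) x)" for n s x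
  have remainder: "\<bar>G n s x\<bar> \<le> exp (L * t) * ((L * s) ^ n / fact n)"
    if "0 \<le> s" "s \<le> t" "x \<in> priority_states" for n s x
    using that
  proof (induction n arbitrary: s x)
    case 0
    have "\<bar>G 0 s x\<bar> \<le> exp (L * s) * 1"
      using u 0 by (auto simp: G_def abs_mult)
    also have "\<dots> \<le> exp (L * t) * 1" using 0 L by simp
    finally show ?case by simp
  next
    case (Suc n)
    let ?\<phi> = "\<lambda>r. exp (L * t) * ((L * r) ^ Suc n / fact (Suc n))"
    have G': "((\<lambda>r. G (Suc n) r x) has_real_derivative L * jump (G n r) x) (at r within {0..})"
      if "0 \<le> r" for r
    proof -
      have "((\<lambda>r. exp (L * r) * u r x) has_real_derivative
              exp (L * r) * (L * (jump (u r) x - u r x)) + exp (L * r) * L * u r x) (at r within {0..})"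
        by (auto intro!: derivative_eq_intros u' that Suc.prems)
      hence "((\<lambda>r. G (Suc n) r x) has_real_derivative
          exp (L * r) * (L * (jump (u r) x - u r x)) + exp (L * r) * L * u r x -
          L * (\<Sum>k<n. (L * r) ^ k / fact k * (jump ^^ Suc k) (u 0) x)) (at r within {0..})"
        unfolding G_def by (rule DERIV_diff[OF _ exp_partial_sum_derivative])
      also have "exp (L * r) * (L * (jump (u r) x - u r x)) + exp (L * r) * L * u r x -
          L * (\<Sum>k<n. (L * r) ^ k / fact k * (jump ^^ Suc k) (u 0) x) = L * jump (G n r) x"
        unfolding G_def jump_sub_sum by (simp add: right_diff_distrib mult.left_commute)
      finally show ?thesis .
    qed
    show ?case
    proof (cases "s = 0")
      case True
      have "G (Suc n) 0 x = 0"
        by (simp add: G_def sum.lessThan_Suc_shift del: sum.lessThan_Suc)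
      thus ?thesis using True by simp
    next
      case False
      hence s: "0 < s" using Suc.prems by simp
      have "norm (G (Suc n) s x - G (Suc n) 0 x) \<le> ?\<phi> s - ?\<phi> 0"
      proof (rule differentiable_bound_general[OF s])
        show "continuous_on {0..s} (\<lambda>r. G (Suc n) r x)"
        proof (rule DERIV_continuous_on)
          fix r assume "r \<in> {0..s}"
          thus "((\<lambda>r. G (Suc n) r x) has_real_derivative L * jump (G n r) x) (at r within {0..s})"
            by (intro DERIV_subset[OF G']) auto
        qed
        show "continuous_on {0..s} ?\<phi>"
          by (intro continuous_intros) auto
      next
        fix r assume r: "0 < r" "r < s"
        have "at r within {0..} = at r"
          using r by (intro at_within_interior) auto
        thus "((\<lambda>r. G (Suc n) r x) has_vector_derivative L * jump (G n r) x) (at r)"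
          using G'[of r] r by (simp add: has_real_derivative_iff_has_vector_derivative)
        show "(?\<phi> has_vector_derivative exp (L * t) * (L * ((L * r) ^ n / fact n))) (at r)"
          unfolding has_real_derivative_iff_has_vector_derivative[symmetric]
          by (rule DERIV_cmult[OF exp_term_derivative])
        have "\<bar>jump (G n r) x\<bar> \<le> jump (\<lambda>y. \<bar>G n r y\<bar>) x"
          by (rule abs_jump_le)
        also have "\<dots> \<le> (jump ^^ 1) (\<lambda>y. exp (L * t) * ((L * r) ^ n / fact n)) x"
          using Suc r by (auto intro!: jump_mono)
        also have "\<dots> = exp (L * t) * ((L * r) ^ n / fact n)"
          by (simp only: jump_iter_const)
        finally have "L * \<bar>jump (G n r) x\<bar> \<le> L * (exp (L * t) * ((L * r) ^ n / fact n))"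
          by (rule mult_left_mono) (use L in simp)
        thus "norm (L * jump (G n r) x) \<le> exp (L * t) * (L * ((L * r) ^ n / fact n))"
          using L by (simp add: abs_mult mult.left_commute)
      qed
      moreover have "G (Suc n) 0 x = 0"
        by (simp add: G_def sum.lessThan_Suc_shift del: sum.lessThan_Suc)
      ultimately show ?thesis by simp
    qed
  qed
  have "(\<lambda>n. (L * t) ^ n / fact n) \<longlonglongrightarrow> 0"
    using summable_LIMSEQ_zero[OF summable_exp[of "L * t"]] by (simp add: divide_inverse mult.commute)
  hence "(\<lambda>n. exp (L * t) * ((L * t) ^ n / fact n)) \<longlonglongrightarrow> 0"
    using tendsto_mult_right_zero by blast
  hence "(\<lambda>n. G n t x) \<longlonglongrightarrow> 0"
    by (rule Lim_null_comparison[rotated]) (use remainder[OF t order_refl x] in auto)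
  hence "(\<lambda>n. exp (L * t) * u t x - G n t x) \<longlonglongrightarrow> exp (L * t) * u t x - 0"
    by (intro tendsto_intros)
  thus ?thesis unfolding sums_def G_def by simp
qed

end

lemma priority_rate_eq:
  assumes "x \<in> priority_states" "z \<noteq> x"
  shows "priority_rate lam\<^sub>1 lam\<^sub>2 \<mu> x z =
    lam\<^sub>1 * of_bool (z = arrival\<^sub>1 x) + lam\<^sub>2 * of_bool (z = arrival\<^sub>2 x) + \<mu> * of_bool (z = service_end x)"
  using assms by (cases rule: priority_states_cases) auto

text \<open>A finite set outside which row \<open>x\<close> of the generator vanishes; it contains \<open>x\<close> itself for the
diagonal entry.\<close>

definition transition_targets :: "state \<Rightarrow> state set" where
  "transition_targets x = {x, arrival\<^sub>1 x, arrival\<^sub>2 x, service_end x}"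

text \<open>A row of the generator is a multiple of the jump operator minus the identity. In the empty state
the fictitious completion cancels against the extra \<open>\<mu>\<close> in the diagonal term.\<close>

lemma generator_row_sum:
  assumes x: "x \<in> priority_states"
  shows "(\<Sum>z\<in>transition_targets x. generator priority_states (priority_rate lam\<^sub>1 lam\<^sub>2 \<mu>) x z * f z) =
    lam\<^sub>1 * f (arrival\<^sub>1 x) + lam\<^sub>2 * f (arrival\<^sub>2 x) + \<mu> * f (service_end x) - (lam\<^sub>1 + lam\<^sub>2 + \<mu>) * f x"
proof -
  define F where "F = transition_targets x"
  define w where "w z = lam\<^sub>1 * of_bool (z = arrival\<^sub>1 x) + lam\<^sub>2 * of_bool (z = arrival\<^sub>2 x) +
    \<mu> * of_bool (z = service_end x)" for z
  have F: "finite F" "x \<in> F" "arrival\<^sub>1 x \<in> F" "arrival\<^sub>2 x \<in> F" "service_end x \<in> F"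
    by (auto simp: F_def transition_targets_def)
  have delta: "(\<Sum>z\<in>F. of_bool (z = y) * h z) = h y" if "y \<in> F" for y and h :: "state \<Rightarrow> real"
  proof -
    have "(\<Sum>z\<in>F. of_bool (z = y) * h z) = (\<Sum>z\<in>F. if z = y then h z else 0)"
      by (intro sum.cong) auto
    thus ?thesis using F(1) that by simp
  qed
  have w: "(\<Sum>z\<in>F. w z * h z) = lam\<^sub>1 * h (arrival\<^sub>1 x) + lam\<^sub>2 * h (arrival\<^sub>2 x) + \<mu> * h (service_end x)" for h
    unfolding w_def distrib_right sum.distrib mult.assoc sum_distrib_left[symmetric]
    by (simp only: delta F)
  have FS: "F \<subseteq> priority_states"
    using x transitions_in_states[OF x] by (simp add: F_def transition_targets_def)
  have w0: "w z = 0" if "z \<notin> F" for z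
    using that by (simp add: F_def transition_targets_def w_def)
  have qw: "priority_rate lam\<^sub>1 lam\<^sub>2 \<mu> x z = w z" if "z \<noteq> x" for z
    unfolding w_def by (rule priority_rate_eq[OF x that])
  have "(\<Sum>\<^sub>\<infinity>z\<in>priority_states - {x}. priority_rate lam\<^sub>1 lam\<^sub>2 \<mu> x z) = (\<Sum>\<^sub>\<infinity>z\<in>F - {x}. w z)"
  proof (rule infsum_cong_neutral)
    show "w z = 0" if "z \<in> (F - {x}) - (priority_states - {x})" for z
      using FS that by blast
    show "priority_rate lam\<^sub>1 lam\<^sub>2 \<mu> x z = 0" if "z \<in> (priority_states - {x}) - (F - {x})" for z
    proof -
      have "z \<notin> F" "z \<noteq> x" using that by blast+
      thus ?thesis by (simp add: qw w0)
    qed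
    show "priority_rate lam\<^sub>1 lam\<^sub>2 \<mu> x z = w z" if "z \<in> (priority_states - {x}) \<inter> (F - {x})" for z
      using qw[of z] that by simp
  qed
  also have "\<dots> = (\<Sum>z\<in>F. w z) - w x"
    using F by (simp add: sum_diff1)
  also have "(\<Sum>z\<in>F. w z) = lam\<^sub>1 + lam\<^sub>2 + \<mu>"
    using w[of "\<lambda>_. 1"] by simp
  finally have "generator priority_states (priority_rate lam\<^sub>1 lam\<^sub>2 \<mu>) x z =
      w z - of_bool (z = x) * (lam\<^sub>1 + lam\<^sub>2 + \<mu>)" for z
    using qw[of z] by (cases "z = x") (simp_all add: generator_def)
  hence "(\<Sum>z\<in>F. generator priority_states (priority_rate lam\<^sub>1 lam\<^sub>2 \<mu>) x z * f z) =
      (\<Sum>z\<in>F. w z * f z) - (\<Sum>z\<in>F. of_bool (z = x) * ((lam\<^sub>1 + lam\<^sub>2 + \<mu>) * f z))"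
    by (simp add: left_diff_distrib sum_subtractf mult.assoc)
  thus ?thesis by (simp only: w delta[OF F(2)] F_def[symmetric])
qed

text \<open>Uniformization at rate \<open>L\<close> expresses the transition probability as the Poisson average, with mean
\<open>L * t\<close>, of expectations of the jump chain, which converge.\<close>

lemma priority_transition_limit:
  fixes lam\<^sub>1 lam\<^sub>2 \<mu> :: real
  defines "L \<equiv> lam\<^sub>1 + lam\<^sub>2 + \<mu>"
  assumes pos: "0 < lam\<^sub>1" "0 < lam\<^sub>2" "0 < \<mu>" and stable: "lam\<^sub>1 + lam\<^sub>2 < \<mu>"
    and P: "transition_function priority_states P"
    and P': "\<And>x y. x \<in> priority_states \<Longrightarrow> y \<in> priority_states \<Longrightarrow> ((\<lambda>t. P t x y) has_real_derivative
        generator priority_states (priority_rate lam\<^sub>1 lam\<^sub>2 \<mu>) x y) (at 0 within {0..})"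
    and x: "x \<in> priority_states" and y: "y \<in> priority_states"
  shows "((\<lambda>t. P t x y) \<longlongrightarrow>
    jump_chain.equilibrium (lam\<^sub>1 / L) (lam\<^sub>2 / L) (\<mu> / L) (\<lambda>z. of_bool (z = y))) at_top"
proof -
  have L: "0 < L" using pos by (simp add: L_def)
  interpret jump_chain "lam\<^sub>1 / L" "lam\<^sub>2 / L" "\<mu> / L"
    by unfold_locales
       (use pos stable L in \<open>auto simp: add_divide_distrib[symmetric] divide_strict_right_mono, simp add: L_def\<close>)
  have targets: "finite (transition_targets z)" "transition_targets z \<subseteq> priority_states"
    "z \<in> transition_targets z" if "z \<in> priority_states" for z
    using that transitions_in_states[OF that] by (simp_all add: transition_targets_def)
  have backward: "((\<lambda>s. P s z y) has_real_derivative L * (jump (\<lambda>z. P t z y) z - P t z y)) (at t within {0..})"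
    if t: "0 \<le> t" and z: "z \<in> priority_states" for t z
  proof -
    have "((\<lambda>s. P s z y) has_real_derivative (\<Sum>v\<in>transition_targets z.
        generator priority_states (priority_rate lam\<^sub>1 lam\<^sub>2 \<mu>) z v * P t v y)) (at t within {0..})"
    proof (rule kolmogorov_backward[OF P z y t targets[OF z] P'[OF z] _ P'])
      show "(\<Sum>v\<in>transition_targets z. generator priority_states (priority_rate lam\<^sub>1 lam\<^sub>2 \<mu>) z v) = 0"
        using generator_row_sum[OF z, of lam\<^sub>1 lam\<^sub>2 \<mu> "\<lambda>_. 1"] by simp
    qed (use targets[OF z] in auto)
    also have "(\<Sum>v\<in>transition_targets z. generator priority_states (priority_rate lam\<^sub>1 lam\<^sub>2 \<mu>) z v * P t v y)
        = L * (jump (\<lambda>z. P t z y) z - P t z y)"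
      unfolding generator_row_sum[OF z] jump_def L_def[symmetric]
      using L by (simp add: right_diff_distrib distrib_left)
    finally show ?thesis .
  qed
  have series: "(\<lambda>n. (L * t) ^ n / fact n * (jump ^^ n) (\<lambda>z. of_bool (z = y)) x) sums (exp (L * t) * P t x y)"
    if t: "0 \<le> t" for t
  proof -
    have "(jump ^^ n) (\<lambda>z. P 0 z y) x = (jump ^^ n) (\<lambda>z. of_bool (z = y)) x" for n
      by (rule jump_iter_cong) (use P x y in \<open>auto simp: transition_function_def\<close>)
    moreover have "(\<lambda>n. (L * t) ^ n / fact n * (jump ^^ n) (\<lambda>z. P 0 z y) x) sums (exp (L * t) * P t x y)"
      using transition_function_bounds[OF P _ y]
      by (intro uniformization[where u = "\<lambda>t z. P t z y"] L backward x t) (auto simp: abs_le_iff)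
    ultimately show ?thesis by simp
  qed
  have "((\<lambda>s. P (s / L) x y) \<longlongrightarrow> equilibrium (\<lambda>z. of_bool (z = y))) at_top"
  proof (rule poisson_average_tendsto[OF equilibrium[OF bounded_of_bool x]])
    fix s :: real assume "0 \<le> s"
    thus "(\<lambda>n. s ^ n / fact n * (jump ^^ n) (\<lambda>z. of_bool (z = y)) x) sums (exp s * P (s / L) x y)"
      using series[of "s / L"] L by simp
  qed
  moreover have "filterlim (\<lambda>t. L * t) at_top at_top"
    by (rule filterlim_tendsto_pos_mult_at_top[OF tendsto_const L filterlim_ident])
  ultimately have "((\<lambda>t. P (L * t / L) x y) \<longlongrightarrow> equilibrium (\<lambda>z. of_bool (z = y))) at_top"
    by (rule filterlim_compose)
  thus ?thesis using L by simp
qed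

section \<open>The stationary probabilities\<close>

theorem theorem1:
  fixes lam\<^sub>1 lam\<^sub>2 \<mu> :: real
    and M :: "'w measure"
    and N\<^sub>1 N\<^sub>2 \<xi> :: "real \<Rightarrow> 'w \<Rightarrow> nat"
    and p :: "nat \<Rightarrow> nat \<Rightarrow> nat \<Rightarrow> real"
  assumes "0 < lam\<^sub>1" and "0 < lam\<^sub>2" and "0 < \<mu>"
    and "(lam\<^sub>1 + lam\<^sub>2) / \<mu> < 1"
    and "priority_queue M lam\<^sub>1 lam\<^sub>2 \<mu> N\<^sub>1 N\<^sub>2 \<xi>"
    and p: "\<And>i j k. p i j k =
      Lim at_top (\<lambda>t. \<P>(\<omega> in M. N\<^sub>1 t \<omega> = i \<and> N\<^sub>2 t \<omega> = j \<and> \<xi> t \<omega> = k))"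
  shows "(\<forall>i j k. ((\<lambda>t. \<P>(\<omega> in M. N\<^sub>1 t \<omega> = i \<and> N\<^sub>2 t \<omega> = j \<and> \<xi> t \<omega> = k))
            \<longlongrightarrow> p i j k) at_top) \<and>
    ((\<lambda>(i, j). p i j 1) has_sum lam\<^sub>1 / \<mu>) ({1..} \<times> {0..}) \<and>
    ((\<lambda>(i, j). p i j 2) has_sum lam\<^sub>2 / \<mu>) ({0..} \<times> {1..}) \<and>
    p 0 0 0 = (\<mu> - lam\<^sub>1 - lam\<^sub>2) / \<mu>"
proof -
  interpret priority_queue M lam\<^sub>1 lam\<^sub>2 \<mu> N\<^sub>1 N\<^sub>2 \<xi> by fact
  define L where "L = lam\<^sub>1 + lam\<^sub>2 + \<mu>"
  have L: "0 < L" using assms(1-3) by (simp add: L_def)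
  have stab: "lam\<^sub>1 + lam\<^sub>2 < \<mu>" using assms(3,4) by (simp add: field_simps)
  interpret jump: jump_chain "lam\<^sub>1 / L" "lam\<^sub>2 / L" "\<mu> / L"
    by unfold_locales
       (use assms(1-3) stab L in \<open>auto simp: add_divide_distrib[symmetric] divide_strict_right_mono, simp add: L_def\<close>)
  let ?q = "\<lambda>y. jump.equilibrium (\<lambda>z. of_bool (z = y))"
  obtain P where P: "transition_function priority_states P"
    and P': "\<And>x y. x \<in> priority_states \<Longrightarrow> y \<in> priority_states \<Longrightarrow> ((\<lambda>t. P t x y) has_real_derivative
        generator priority_states (priority_rate lam\<^sub>1 lam\<^sub>2 \<mu>) x y) (at 0 within {0..})"
    and chain: "\<And>(n::nat) \<tau> s. 0 \<le> \<tau> 0 \<Longrightarrow> strict_mono \<tau> \<Longrightarrow> (\<forall>m. s m \<in> priority_states) \<Longrightarrow>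
         \<P>(\<omega> in M. \<forall>m\<le>n. (N\<^sub>1 (\<tau> m) \<omega>, N\<^sub>2 (\<tau> m) \<omega>, \<xi> (\<tau> m) \<omega>) = s m) \<noteq> 0 \<Longrightarrow>
         \<P>(\<omega> in M. (N\<^sub>1 (\<tau> (Suc n)) \<omega>, N\<^sub>2 (\<tau> (Suc n)) \<omega>, \<xi> (\<tau> (Suc n)) \<omega>) = s (Suc n)
            \<bar> \<forall>m\<le>n. (N\<^sub>1 (\<tau> m) \<omega>, N\<^sub>2 (\<tau> m) \<omega>, \<xi> (\<tau> m) \<omega>) = s m)
           = P (\<tau> (Suc n) - \<tau> n) (s n) (s (Suc n))"
    using markov by blast
  have lim: "((\<lambda>t. \<P>(\<omega> in M. (N\<^sub>1 t \<omega>, N\<^sub>2 t \<omega>, \<xi> t \<omega>) = y)) \<longlongrightarrow> ?q y) at_top"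
    if y: "y \<in> priority_states" for y
  proof (rule marginal_limit[OF P _ y])
    fix t :: real and x
    assume t: "0 < t" and x: "x \<in> priority_states"
      and x0: "\<P>(\<omega> in M. (N\<^sub>1 0 \<omega>, N\<^sub>2 0 \<omega>, \<xi> 0 \<omega>) = x) \<noteq> 0"
    have "strict_mono (\<lambda>m. real m * t)" using t by (simp add: strict_mono_def)
    \<comment> \<open>The Markov property is used only for the two times 0 and \<open>t\<close>; the later times of the sequence are fillers.\<close>
    from chain[OF _ this, of "case_nat x (\<lambda>_. y)" 0]
    show "\<P>(\<omega> in M. (N\<^sub>1 t \<omega>, N\<^sub>2 t \<omega>, \<xi> t \<omega>) = y \<bar> (N\<^sub>1 0 \<omega>, N\<^sub>2 0 \<omega>, \<xi> 0 \<omega>) = x) = P t x y"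
      using x y x0 by (simp split: nat.split)
  next
    show "((\<lambda>t. P t x y) \<longlongrightarrow> ?q y) at_top" if "x \<in> priority_states" for x
      unfolding L_def using assms(1-3) stab P P' that y by (rule priority_transition_limit)
  qed
  have triple: "\<P>(\<omega> in M. N\<^sub>1 t \<omega> = i \<and> N\<^sub>2 t \<omega> = j \<and> \<xi> t \<omega> = k) =
      \<P>(\<omega> in M. (N\<^sub>1 t \<omega>, N\<^sub>2 t \<omega>, \<xi> t \<omega>) = (i, j, k))" for t i j k by simp
  have lim': "((\<lambda>t. \<P>(\<omega> in M. N\<^sub>1 t \<omega> = i \<and> N\<^sub>2 t \<omega> = j \<and> \<xi> t \<omega> = k)) \<longlongrightarrow>
      (if (i, j, k) \<in> priority_states then ?q (i, j, k) else 0)) at_top" for i j k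
  proof (cases "(i, j, k) \<in> priority_states")
    case True
    thus ?thesis using lim[OF True] unfolding triple by simp
  next
    case False
    have "\<P>(\<omega> in M. N\<^sub>1 t \<omega> = i \<and> N\<^sub>2 t \<omega> = j \<and> \<xi> t \<omega> = k) = 0" if t: "0 \<le> t" for t
    proof -
      have "{\<omega>\<in>space M. N\<^sub>1 t \<omega> = i \<and> N\<^sub>2 t \<omega> = j \<and> \<xi> t \<omega> = k} = {}"
        using measurable_space[OF measurable_process[OF t]] False by auto
      thus ?thesis by (simp only: measure_empty)
    qed
    hence "\<forall>\<^sub>F t in at_top. 0 = \<P>(\<omega> in M. N\<^sub>1 t \<omega> = i \<and> N\<^sub>2 t \<omega> = j \<and> \<xi> t \<omega> = k)"
      by (intro eventually_mono[OF eventually_ge_at_top[of 0]]) simp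
    thus ?thesis using False by (auto intro: Lim_transform_eventually[OF tendsto_const])
  qed
  have p_eq: "p i j k = (if (i, j, k) \<in> priority_states then ?q (i, j, k) else 0)" for i j k
    unfolding p by (rule tendsto_Lim[OF _ lim']) simp
  have class_sum: "((\<lambda>(i, j). p i j k) has_sum jump.equilibrium (\<lambda>x. of_bool (snd (snd x) = k))) A"
    if A: "\<And>i j. (i, j) \<in> A \<longleftrightarrow> (i, j, k) \<in> priority_states" for A k
  proof -
    let ?h = "\<lambda>(i, j). (i, j, k)"
    have sub: "?h ` A \<subseteq> priority_states" using A by auto
    have inj: "inj_on ?h A" by (auto simp: inj_on_def)
    have mem: "x \<in> ?h ` A \<longleftrightarrow> snd (snd x) = k" if "x \<in> priority_states" for x
    proof -
      obtain i j l where x: "x = (i, j, l)" by (cases x)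
      have "x \<in> ?h ` A \<longleftrightarrow> (i, j) \<in> A \<and> l = k" by (force simp: x)
      thus ?thesis using that A by (auto simp: x)
    qed
    have "jump.equilibrium (\<lambda>x. of_bool (x \<in> ?h ` A)) = jump.equilibrium (\<lambda>x. of_bool (snd (snd x) = k))"
      by (rule jump.equilibrium_cong) (simp only: mem)
    with jump.equilibrium_has_sum[OF sub]
    have "((?q \<circ> ?h) has_sum jump.equilibrium (\<lambda>x. of_bool (snd (snd x) = k))) A"
      unfolding has_sum_reindex[OF inj, symmetric] by simp
    thus ?thesis
      by (rule has_sum_cong[THEN iffD1, rotated]) (use A in \<open>auto simp: p_eq\<close>)
  qed
  have 1: "((\<lambda>(i, j). p i j 1) has_sum lam\<^sub>1 / \<mu>) ({1..} \<times> {0..})"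
    using class_sum[of "{1..} \<times> {0..}" 1] L jump.equilibrium_class_1
    by (simp add: priority_states_def)
  have 2: "((\<lambda>(i, j). p i j 2) has_sum lam\<^sub>2 / \<mu>) ({0..} \<times> {1..})"
    using class_sum[of "{0..} \<times> {1..}" 2] L jump.equilibrium_class_2
    by (simp add: priority_states_def)
  have 0: "p 0 0 0 = (\<mu> - lam\<^sub>1 - lam\<^sub>2) / \<mu>"
    using jump.equilibrium_empty empty_in_states L assms(3)
    by (simp add: p_eq add_divide_distrib[symmetric]) (simp add: field_simps)
  show ?thesis
    using lim' 1 2 0 unfolding p_eq[symmetric] by blast
qed

end
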